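(* Let $\mathcal{L}=(L,\wedge,\vee,0,1)$ be a complete lattice, let $X\subseteq L\setminus\{1\}$, and consider $(X,\tau^{cl})$. If $X$ satisfies the radical condition, then $\mathcal{C}(\mathcal{L})$ satisfies the ACC if and only if $(X,\tau^{\mathfrak{fp}})$ is compact. It follows that, if $\mathcal{C}(\mathcal{L})$ satisfies the ACC and $X$ satisfies the radical condition, then $(X,\tau^{cl})$ is spectral.
   Context: For $a\in L$ put $V(a)=\{p\in X\mid a\le p\}$. The classical Zariski topology $\tau^{cl}$ on $X$ is the topology having $\{X\setminus V(a)\mid a\in L\}$ as a subbase. The finer patch topology $\tau^{\mathfrak{fp}}$ on $X$ is the topology having $\{V(a)\cap (X\setminus V(b))\mid a,b\in L\}$ as a subbase. For $a\in L$ put $\sqrt a=\bigwedge_{p\in V(a)}p$ (empty meet equal to $1$). $\mathcal{C}(\mathcal{L})$ denotes the set $\mathcal{C}(L)=\{a\in L\mid\sqrt a=a\}$ with the induced order (a complete lattice). ACC is the ascending chain condition. Put $\mathcal{R}(\mathcal{L})=\{\sqrt x\mid x\in L \text{ and } V(x)\text{ is irreducible in }(X,\tau^{cl})\}$. $X$ satisfies the radical condition iff $\mathcal{R}(\mathcal{L})\subseteq X$. A subset $A$ of a topological space is irreducible iff it is non-empty and, for any closed sets $F_1,F_2$ with $A\subseteq F_1\cup F_2$, one has $A\subseteq F_1$ or $A\subseteq F_2$. Compact means that every open cover has a finite subcover (no separation axiom is assumed). A topological space is spectral iff it is homeomorphic to $Spec(R)$ with the Zariski topology for some commutative ring $R$.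 *)

theory Defs
  imports "HOL-Analysis.Abstract_Topology" "HOL-Algebra.Ideal"
begin

subsection \<open>Spectral spaces\<close>

definition prime_spectrum :: "('r, 'm) ring_scheme \<Rightarrow> 'r set set" where
  "prime_spectrum R = {P. primeideal P R}"

definition Spec_zero_set :: "('r, 'm) ring_scheme \<Rightarrow> 'r set \<Rightarrow> 'r set set" where
  "Spec_zero_set R E = {P \<in> prime_spectrum R. E \<subseteq> P}"

definition Spec_topology :: "('r, 'm) ring_scheme \<Rightarrow> 'r set topology" where
  "Spec_topology R =
     topology (\<lambda>U. \<exists>E \<subseteq> carrier R. U = prime_spectrum R - Spec_zero_set R E)"

lemma istopology_Spec:
  "istopology (\<lambda>U. \<exists>E \<subseteq> carrier R. U = prime_spectrum R - Spec_zero_set R E)"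
  unfolding istopology_def
proof (intro conjI allI impI)
  fix S T
  assume "\<exists>E \<subseteq> carrier R. S = prime_spectrum R - Spec_zero_set R E"
    and "\<exists>E \<subseteq> carrier R. T = prime_spectrum R - Spec_zero_set R E"
  then obtain E F where EF: "E \<subseteq> carrier R" "F \<subseteq> carrier R"
    and S: "S = prime_spectrum R - Spec_zero_set R E"
    and T: "T = prime_spectrum R - Spec_zero_set R F"
    by blast
  define G where "G = {x \<otimes>\<^bsub>R\<^esub> y | x y. x \<in> E \<and> y \<in> F}"
  have key: "G \<subseteq> P \<longleftrightarrow> E \<subseteq> P \<or> F \<subseteq> P" if P: "P \<in> prime_spectrum R" for P
  proof -
    interpret primeideal P R
      using P by (simp add: prime_spectrum_def)
    show ?thesis
    proof
      assume GP: "G \<subseteq> P"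
      show "E \<subseteq> P \<or> F \<subseteq> P"
      proof (rule ccontr)
        assume "\<not> (E \<subseteq> P \<or> F \<subseteq> P)"
        then obtain x y where xy: "x \<in> E" "x \<notin> P" "y \<in> F" "y \<notin> P" by auto
        then have "x \<otimes>\<^bsub>R\<^esub> y \<in> P" using GP unfolding G_def by auto
        with xy EF I_prime[of x y] show False by auto
      qed
    next
      assume "E \<subseteq> P \<or> F \<subseteq> P"
      with EF show "G \<subseteq> P"
        unfolding G_def by (auto intro: I_l_closed I_r_closed)
    qed
  qed
  show "\<exists>E \<subseteq> carrier R. S \<inter> T = prime_spectrum R - Spec_zero_set R E"
  proof (cases "prime_spectrum R = {}")
    case True
    then show ?thesis using S EF by auto
  next
    case False
    then obtain P where "primeideal P R" by (auto simp: prime_spectrum_def)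
    then interpret primeideal P R .
    have "G \<subseteq> carrier R"
      using EF unfolding G_def by auto
    moreover have "S \<inter> T = prime_spectrum R - Spec_zero_set R G"
      unfolding S T Spec_zero_set_def using key by auto
    ultimately show ?thesis by blast
  qed
next
  fix \<K>
  assume *: "\<forall>K\<in>\<K>. \<exists>E \<subseteq> carrier R. K = prime_spectrum R - Spec_zero_set R E"
  from bchoice[OF *] obtain E where
    E: "\<forall>K\<in>\<K>. E K \<subseteq> carrier R \<and> K = prime_spectrum R - Spec_zero_set R (E K)"
    by blast
  have "\<Union>\<K> = (\<Union>K\<in>\<K>. prime_spectrum R - Spec_zero_set R (E K))"
    using E by auto
  also have "\<dots> = prime_spectrum R - Spec_zero_set R (\<Union>K\<in>\<K>. E K)"
    unfolding Spec_zero_set_def by blast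
  finally show "\<exists>E \<subseteq> carrier R. \<Union>\<K> = prime_spectrum R - Spec_zero_set R E"
    using E by (intro exI[of _ "\<Union>K\<in>\<K>. E K"]) auto
qed

lemma openin_Spec_topology:
  "openin (Spec_topology R) U \<longleftrightarrow>
     (\<exists>E \<subseteq> carrier R. U = prime_spectrum R - Spec_zero_set R E)"
  unfolding Spec_topology_def by (simp add: topology_inverse'[OF istopology_Spec])

text \<open>
  HOL cannot quantify existentially over types, so the carrier type of the ring has to be named.
  The type below loses no generality: by Hochster's construction a spectral space is homeomorphic
  to the spectrum of a ring whose cardinality is at most the maximum of aleph-zero and the number
  of quasi-compact open sets, and the space has at most as many open sets as there are elements of
  \<open>'a set\<close>. The summand \<open>nat\<close> is needed because a finite space may require an infinite ring.
  The zero ring is allowed, so the empty space is spectral.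
\<close>

definition spectral_space :: "'a topology \<Rightarrow> bool" where
  "spectral_space T \<longleftrightarrow>
     (\<exists>R :: ('a + nat) set set ring. cring R \<and> T homeomorphic_space Spec_topology R)"

definition irreducible_in :: "'a topology \<Rightarrow> 'a set \<Rightarrow> bool" where
  "irreducible_in T A \<longleftrightarrow> A \<subseteq> topspace T \<and> A \<noteq> {} \<and>
     (\<forall>F1 F2. closedin T F1 \<and> closedin T F2 \<and> A \<subseteq> F1 \<union> F2 \<longrightarrow> A \<subseteq> F1 \<or> A \<subseteq> F2)"


subsection \<open>Subsets of a complete lattice\<close>

text \<open>
  The lattice \<open>L\<close> is the type \<open>'a\<close>, with least element \<open>0 = bot_class.bot\<close> and greatest
  element \<open>1 = top_class.top\<close>; the unqualified name \<open>top\<close> refers to a constant of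
  \<open>HOL-Algebra\<close>. All notions depend on the subset \<open>X\<close> of \<open>L\<close>, which is therefore an explicit
  argument.
\<close>

definition V :: "'a::complete_lattice set \<Rightarrow> 'a \<Rightarrow> 'a set" where
  "V X a = {p \<in> X. a \<le> p}"

definition zariski_cl :: "'a::complete_lattice set \<Rightarrow> 'a topology" where
  "zariski_cl X = topology_generated_by {X - V X a | a. True}"

definition patch_topology :: "'a::complete_lattice set \<Rightarrow> 'a topology" where
  "patch_topology X = topology_generated_by {V X a \<inter> (X - V X b) | a b. True}"

lemma topspace_zariski_cl:
  assumes "X \<subseteq> UNIV - {top_class.top}"
  shows "topspace (zariski_cl X) = X"
proof -
  have "V X top_class.top = {}"
    using assms by (auto simp: V_def top_unique)
  then have "X \<in> {X - V X a | a. True}"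
    by blast
  then show ?thesis
    unfolding zariski_cl_def topology_generated_by_topspace by auto
qed

lemma topspace_patch_topology:
  assumes "X \<subseteq> UNIV - {top_class.top}"
  shows "topspace (patch_topology X) = X"
proof -
  have "V X top_class.top = {}" "V X bot_class.bot = X"
    using assms by (auto simp: V_def top_unique)
  then have "X = V X bot_class.bot \<inter> (X - V X top_class.top)"
    by simp
  then have "X \<in> {V X a \<inter> (X - V X b) | a b. True}"
    by blast
  then show ?thesis
    unfolding patch_topology_def topology_generated_by_topspace by auto
qed

definition radical :: "'a::complete_lattice set \<Rightarrow> 'a \<Rightarrow> 'a" where
  "radical X a = Inf (V X a)"

definition radical_elements :: "'a::complete_lattice set \<Rightarrow> 'a set" where
  "radical_elements X = {a. radical X a = a}"

definition irreducible_radicals :: "'a::complete_lattice set \<Rightarrow> 'a set" where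
  "irreducible_radicals X = {radical X x | x. irreducible_in (zariski_cl X) (V X x)}"

definition radical_condition :: "'a::complete_lattice set \<Rightarrow> bool" where
  "radical_condition X \<longleftrightarrow> irreducible_radicals X \<subseteq> X"

definition ACC_on :: "'a::order set \<Rightarrow> bool" where
  "ACC_on C \<longleftrightarrow>
     (\<forall>c :: nat \<Rightarrow> 'a. range c \<subseteq> C \<and> mono c \<longrightarrow> (\<exists>N. \<forall>n\<ge>N. c n = c N))"

end

theory Submission
  imports Defs "HOL-Library.Poly_Mapping" "HOL-Library.Countable"
    "HOL-Computational_Algebra.Fraction_Field"
begin

text \<open>
  The sets \<open>V X a\<close> are closed under intersection, and taking radicals identifies them, with reversed
  order, with the radical elements. So the ascending chain condition is the descending chain condition
  for the sets \<open>V X a\<close>. Each of them is clopen in the patch topology, which turns compactness of the patch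
  topology into the chain condition (\<open>ACC_of_compact_patch\<close>). Conversely, Noetherian induction shows that
  every \<open>V X a\<close> is patch-compact; the radical condition enters by giving irreducible sets \<open>V X a\<close> a generic
  point (\<open>compactin_V\<close>).

  It remains to show that \<open>X\<close> with the classical topology is spectral as soon as its patch topology is
  compact, an instance of Hochster's theorem. Let \<open>K\<close> be the field of rational functions over the rationals
  in indeterminates \<open>T\<^sub>a\<close>, one for each element \<open>a\<close> of the lattice. For \<open>y \<in> X\<close> let \<open>K\<^sub>y\<close> be the subfield generated
  by those \<open>T\<^sub>a\<close> with \<open>a \<le> y\<close> false, and let \<open>v\<^sub>y\<close> be the integer-valued valuation of \<open>K\<close> that measures the order of
  vanishing in the other indeterminates; it is trivial on \<open>K\<^sub>y\<close>. Consider the ring \<open>R\<close> of all functions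
  \<open>f : X \<rightarrow> K\<close>, locally constant in the patch topology, such that \<open>f x \<in> K\<^sub>x\<close> for all \<open>x\<close>, and
  \<open>v\<^sub>y (f x - f y) > 0\<close> whenever \<open>x \<le> y\<close>. Each point \<open>x\<close> gives the prime ideal of all \<open>f\<close> with \<open>f x = 0\<close>. The
  functions equal to \<open>T\<^sub>a\<close> on \<open>X - V X a\<close> and to \<open>0\<close> elsewhere belong to \<open>R\<close>, so that the topology of \<open>X\<close> can
  be recovered from the zeros of the elements of \<open>R\<close>.

  The point of the construction is that \<open>R\<close> satisfies a Nullstellensatz: if \<open>g\<close> vanishes at all zeros of
  \<open>f\<close>, then \<open>g ^ n / f\<close> is again in \<open>R\<close> for large \<open>n\<close> (\<open>section_quotient\<close>). Together with compactness of the
  patch topology this implies that every prime ideal comes from a point (\<open>prime_is_point\<close>), and that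
  \<open>X\<close> is homeomorphic to the spectrum of \<open>R\<close> (\<open>zariski_homeomorphic_Spec\<close>). Finally, \<open>R\<close> is small enough to
  be copied into the type that the definition of a spectral space prescribes for the carrier
  (\<open>ex_inj_into_double_powerset\<close>).
\<close>

section \<open>Linearly ordered indeterminates\<close>

text \<open>
  Multivariate polynomials form an integral domain once the type of exponents is linearly ordered,
  which follows from a linear order on the indeterminates. The points of an arbitrary type are
  therefore copied into a type of indeterminates that is ordered by some well-ordering.
\<close>

typedef 'a indet = "UNIV :: 'a set" morphisms index Indet ..

lemma index_Indet [simp]: "index (Indet a) = a"
  by (simp add: Indet_inverse)

instantiation indet :: (type) linorder
begin

definition less_eq_indet where
  "(v :: 'a indet) \<le> w \<longleftrightarrow> (v, w) \<in> (SOME r. Well_order r \<and> Field r = UNIV)"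

definition less_indet where
  "(v :: 'a indet) < w \<longleftrightarrow> v \<le> w \<and> \<not> w \<le> v"

instance
proof
  fix u v w :: "'a indet"
  have "\<exists>r :: 'a indet rel. Well_order r \<and> Field r = UNIV"
    by (rule well_ordering)
  then have "Well_order (SOME r :: 'a indet rel. Well_order r \<and> Field r = UNIV) \<and>
      Field (SOME r :: 'a indet rel. Well_order r \<and> Field r = UNIV) = UNIV"
    by (rule someI_ex)
  then obtain r :: "'a indet rel" where r: "Well_order r" "Field r = UNIV"
    and le: "\<And>v w. v \<le> w \<longleftrightarrow> (v, w) \<in> r"
    unfolding less_eq_indet_def by blast
  have lin: "refl r" "trans r" "antisym r" "total r"
    using r by (simp_all add: order_on_defs)
  show "v < w \<longleftrightarrow> v \<le> w \<and> \<not> w \<le> v"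
    by (fact less_indet_def)
  show "v \<le> v" "v \<le> w \<or> w \<le> v"
    unfolding le using lin unfolding refl_on_def total_on_def by (auto, metis)
  show "u \<le> v \<Longrightarrow> v \<le> w \<Longrightarrow> u \<le> w" "v \<le> w \<Longrightarrow> w \<le> v \<Longrightarrow> v = w"
    unfolding le using lin by (auto dest: transD antisymD)
qed

end

section \<open>Orders of vanishing of polynomials\<close>

type_synonym 'v mpoly = "('v \<Rightarrow>\<^sub>0 nat) \<Rightarrow>\<^sub>0 rat"

definition degree_in :: "'v set \<Rightarrow> ('v \<Rightarrow>\<^sub>0 nat) \<Rightarrow> nat" where
  "degree_in S m = (\<Sum>v\<in>Poly_Mapping.keys m \<inter> S. Poly_Mapping.lookup m v)"

text \<open>
  The order of vanishing of a nonzero \<open>p\<close> along the linear subspace on which all indeterminates of \<open>S\<close> are zero.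
\<close>

definition ord_in :: "'v set \<Rightarrow> 'v mpoly \<Rightarrow> nat" where
  "ord_in S p = Min (degree_in S ` Poly_Mapping.keys p)"

definition polys_over :: "'v set \<Rightarrow> 'v mpoly set" where
  "polys_over S = {p. \<forall>m\<in>Poly_Mapping.keys p. Poly_Mapping.keys m \<subseteq> S}"

lemma degree_in_superset:
  assumes "finite A" "Poly_Mapping.keys m \<subseteq> A"
  shows "degree_in S m = (\<Sum>v\<in>A \<inter> S. Poly_Mapping.lookup m v)"
  unfolding degree_in_def using assms
  by (intro sum.mono_neutral_left) (auto simp: in_keys_iff)

lemma degree_in_add: "degree_in S (m + n) = degree_in S m + degree_in S n"
proof -
  let ?A = "Poly_Mapping.keys m \<union> Poly_Mapping.keys n"
  have "degree_in S (m + n) = (\<Sum>v\<in>?A \<inter> S. Poly_Mapping.lookup (m + n) v)"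
    by (intro degree_in_superset) (use keys_add[of m n] in auto)
  also have "\<dots> = (\<Sum>v\<in>?A \<inter> S. Poly_Mapping.lookup m v) + (\<Sum>v\<in>?A \<inter> S. Poly_Mapping.lookup n v)"
    by (simp add: lookup_add sum.distrib)
  also have "\<dots> = degree_in S m + degree_in S n"
    by (simp add: degree_in_superset[of ?A])
  finally show ?thesis .
qed

lemma degree_in_zero [simp]: "degree_in S 0 = 0"
  by (simp add: degree_in_def)

lemma degree_in_le: "degree_in S m \<le> degree_in UNIV m"
  unfolding degree_in_def by (intro sum_mono2) auto

lemma degree_in_disjoint: "Poly_Mapping.keys m \<inter> S = {} \<Longrightarrow> degree_in S m = 0"
  by (simp add: degree_in_def)

lemma ord_in_le: "m \<in> Poly_Mapping.keys p \<Longrightarrow> ord_in S p \<le> degree_in S m"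
  by (simp add: ord_in_def)

lemma ord_in_attained:
  assumes "p \<noteq> 0"
  obtains m where "m \<in> Poly_Mapping.keys p" "degree_in S m = ord_in S p"
proof -
  have "ord_in S p \<in> degree_in S ` Poly_Mapping.keys p"
    unfolding ord_in_def using assms by (intro Min_in) auto
  then show ?thesis using that by force
qed

lemma ord_in_add:
  assumes "p + q \<noteq> 0"
  shows "min (ord_in S p) (ord_in S q) \<le> ord_in S (p + q)"
proof -
  obtain m where m: "m \<in> Poly_Mapping.keys (p + q)" "degree_in S m = ord_in S (p + q)"
    using ord_in_attained[OF assms] .
  then have "m \<in> Poly_Mapping.keys p \<or> m \<in> Poly_Mapping.keys q"
    using keys_add[of p q] by blast
  then show ?thesis
    using m ord_in_le by (metis min.coboundedI1 min.coboundedI2)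
qed

text \<open>
  The homogeneous component of lowest degree, where only the indeterminates of \<open>S\<close> are counted.
\<close>

definition initial_form :: "'v set \<Rightarrow> 'v mpoly \<Rightarrow> 'v mpoly" where
  "initial_form S p =
     Abs_poly_mapping (\<lambda>m. if degree_in S m = ord_in S p then Poly_Mapping.lookup p m else 0)"

lemma lookup_initial_form:
  "Poly_Mapping.lookup (initial_form S p) m =
     (if degree_in S m = ord_in S p then Poly_Mapping.lookup p m else 0)"
  unfolding initial_form_def
  by (subst lookup_Abs_poly_mapping) (auto intro: finite_subset[OF _ finite_lookup[of p]])

lemma initial_form_nonzero: "p \<noteq> 0 \<Longrightarrow> initial_form S p \<noteq> 0"
  by (metis in_keys_iff lookup_initial_form lookup_zero ord_in_attained)

lemma degree_initial_form:
  "m \<in> Poly_Mapping.keys (initial_form S p) \<Longrightarrow> degree_in S m = ord_in S p"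
  by (auto simp: in_keys_iff lookup_initial_form split: if_splits)

lemma degree_remainder:
  assumes "m \<in> Poly_Mapping.keys (p - initial_form S p)"
  shows "ord_in S p < degree_in S m"
proof -
  have "m \<in> Poly_Mapping.keys p" "degree_in S m \<noteq> ord_in S p"
    using assms by (auto simp: in_keys_iff lookup_minus lookup_initial_form split: if_splits)
  then show ?thesis
    using ord_in_le[of m p S] by simp
qed

text \<open>
  The initial form of a product is the product of the initial forms. This product is nonzero because
  polynomials form a domain, and all other terms of \<open>p * q\<close> have a larger degree, so nothing cancels it.
\<close>

lemma ord_in_mult:
  fixes p q :: "('v::linorder) mpoly"
  assumes "p \<noteq> 0" "q \<noteq> 0"
  shows "ord_in S (p * q) = ord_in S p + ord_in S q"
proof (rule antisym)
  define p0 q0 where "p0 = initial_form S p" and "q0 = initial_form S q"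
  define r where "r = p0 * (q - q0) + (p - p0) * q"
  have pq: "p * q = p0 * q0 + r"
    by (simp add: r_def algebra_simps)
  have "p0 * q0 \<noteq> 0"
    using assms by (simp add: p0_def q0_def initial_form_nonzero)
  then obtain m where m: "m \<in> Poly_Mapping.keys (p0 * q0)"
    by fastforce
  then have deg_m: "degree_in S m = ord_in S p + ord_in S q"
    using keys_mult[of p0 q0] by (auto simp: degree_in_add p0_def q0_def degree_initial_form)
  have "ord_in S p + ord_in S q < degree_in S n" if "n \<in> Poly_Mapping.keys r" for n
  proof -
    have "n \<in> Poly_Mapping.keys (p0 * (q - q0)) \<or> n \<in> Poly_Mapping.keys ((p - p0) * q)"
      using that keys_add[of "p0 * (q - q0)" "(p - p0) * q"] unfolding r_def by blast
    then show ?thesis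
    proof
      assume "n \<in> Poly_Mapping.keys (p0 * (q - q0))"
      then obtain a b where "n = a + b" "a \<in> Poly_Mapping.keys p0" "b \<in> Poly_Mapping.keys (q - q0)"
        using keys_mult[of p0 "q - q0"] by blast
      then show ?thesis
        using degree_initial_form[of a S p] degree_remainder[of b q S]
        by (simp add: degree_in_add p0_def q0_def)
    next
      assume "n \<in> Poly_Mapping.keys ((p - p0) * q)"
      then obtain a b where "n = a + b" "a \<in> Poly_Mapping.keys (p - p0)" "b \<in> Poly_Mapping.keys q"
        using keys_mult[of "p - p0" q] by blast
      then show ?thesis
        using degree_remainder[of a p S] ord_in_le[of b q S]
        by (simp add: degree_in_add p0_def)
    qed
  qed
  then have "m \<notin> Poly_Mapping.keys r"
    using deg_m by force
  then have "m \<in> Poly_Mapping.keys (p * q)"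
    using m by (simp add: pq in_keys_iff lookup_add)
  then show "ord_in S (p * q) \<le> ord_in S p + ord_in S q"
    using ord_in_le deg_m by metis
next
  have "p * q \<noteq> 0"
    using assms by simp
  then obtain m where m: "m \<in> Poly_Mapping.keys (p * q)" "degree_in S m = ord_in S (p * q)"
    using ord_in_attained by blast
  then obtain a b where "m = a + b" "a \<in> Poly_Mapping.keys p" "b \<in> Poly_Mapping.keys q"
    using keys_mult[of p q] by blast
  then show "ord_in S p + ord_in S q \<le> ord_in S (p * q)"
    using m ord_in_le[of a p S] ord_in_le[of b q S] by (simp add: degree_in_add)
qed

text \<open>
  The bound does not depend on \<open>S\<close>: the total degree of any monomial of \<open>p\<close> will do. This uniformity is
  what later allows a single exponent to work for infinitely many valuations at once.
\<close>

lemma ord_in_bounded: "p \<noteq> 0 \<Longrightarrow> \<exists>N. \<forall>S. ord_in S p \<le> N"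
  by (metis degree_in_le le_trans ord_in_attained ord_in_le)

lemma ord_in_polys_over:
  assumes "p \<in> polys_over (- S)" "p \<noteq> 0"
  shows "ord_in S p = 0"
proof -
  obtain m where "m \<in> Poly_Mapping.keys p" "degree_in S m = ord_in S p"
    using ord_in_attained[OF assms(2)] .
  moreover from this have "Poly_Mapping.keys m \<inter> S = {}"
    using assms by (auto simp: polys_over_def)
  ultimately show ?thesis
    using degree_in_disjoint by metis
qed

lemma polys_over_add: "p \<in> polys_over S \<Longrightarrow> q \<in> polys_over S \<Longrightarrow> p + q \<in> polys_over S"
  using keys_add[of p q] unfolding polys_over_def by blast

lemma polys_over_mult:
  assumes "p \<in> polys_over S" "q \<in> polys_over S"
  shows "p * q \<in> polys_over S"
  unfolding polys_over_def
proof (intro CollectI ballI)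
  fix m assume "m \<in> Poly_Mapping.keys (p * q)"
  then obtain a b where "m = a + b" "a \<in> Poly_Mapping.keys p" "b \<in> Poly_Mapping.keys q"
    using keys_mult[of p q] by blast
  then show "Poly_Mapping.keys m \<subseteq> S"
    using assms keys_add[of a b] unfolding polys_over_def by blast
qed

lemma polys_over_single:
  "Poly_Mapping.keys m \<subseteq> S \<Longrightarrow> Poly_Mapping.single m c \<in> polys_over S"
  by (simp add: polys_over_def)

lemma polys_over_one [simp]: "1 \<in> polys_over S"
  by (simp add: polys_over_def)

lemma polys_over_uminus: "p \<in> polys_over S \<Longrightarrow> - p \<in> polys_over S"
  by (simp add: polys_over_def in_keys_iff)

section \<open>Rational functions and their valuations\<close>

definition val :: "('v::linorder) set \<Rightarrow> 'v mpoly fract \<Rightarrow> int" where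
  "val S z = (SOME i. \<exists>p q. p \<noteq> 0 \<and> q \<noteq> 0 \<and> z = Fract p q \<and> i = int (ord_in S p) - int (ord_in S q))"

lemma val_Fract:
  assumes "p \<noteq> 0" "q \<noteq> 0"
  shows "val S (Fract p q) = int (ord_in S p) - int (ord_in S q)"
  unfolding val_def
proof (rule some_equality)
  show "\<exists>p' q'. p' \<noteq> 0 \<and> q' \<noteq> 0 \<and> Fract p q = Fract p' q' \<and>
      int (ord_in S p) - int (ord_in S q) = int (ord_in S p') - int (ord_in S q')"
    using assms by blast
next
  fix i
  assume "\<exists>p' q'. p' \<noteq> 0 \<and> q' \<noteq> 0 \<and> Fract p q = Fract p' q' \<and>
      i = int (ord_in S p') - int (ord_in S q')"
  then obtain p' q' where *: "p' \<noteq> 0" "q' \<noteq> 0" "Fract p q = Fract p' q'"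
    and i: "i = int (ord_in S p') - int (ord_in S q')"
    by blast
  then have "ord_in S (p * q') = ord_in S (p' * q)"
    using assms by (simp add: eq_fract)
  then show "i = int (ord_in S p) - int (ord_in S q)"
    using * assms i by (simp add: ord_in_mult)
qed

lemma fract_nonzero_cases:
  fixes z :: "('d::idom) fract"
  assumes "z \<noteq> 0"
  obtains p q where "p \<noteq> 0" "q \<noteq> 0" "z = Fract p q"
  using assms by (metis Fract_cases_nonzero)

lemma val_mult:
  assumes "z \<noteq> 0" "w \<noteq> 0"
  shows "val S (z * w) = val S z + val S w"
proof -
  obtain p q where 1: "p \<noteq> 0" "q \<noteq> 0" "z = Fract p q"
    using fract_nonzero_cases[OF assms(1)] .
  obtain p' q' where 2: "p' \<noteq> 0" "q' \<noteq> 0" "w = Fract p' q'"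
    using fract_nonzero_cases[OF assms(2)] .
  show ?thesis
    using 1 2 by (simp add: val_Fract ord_in_mult)
qed

lemma val_add:
  assumes "z \<noteq> 0" "w \<noteq> 0" "z + w \<noteq> 0"
  shows "min (val S z) (val S w) \<le> val S (z + w)"
proof -
  obtain p q where 1: "p \<noteq> 0" "q \<noteq> 0" "z = Fract p q"
    using fract_nonzero_cases[OF assms(1)] .
  obtain p' q' where 2: "p' \<noteq> 0" "q' \<noteq> 0" "w = Fract p' q'"
    using fract_nonzero_cases[OF assms(2)] .
  have sum: "z + w = Fract (p * q' + p' * q) (q * q')"
    using 1 2 by simp
  then have num: "p * q' + p' * q \<noteq> 0"
    using assms(3) by (auto simp: fract_collapse)
  have "min (ord_in S (p * q')) (ord_in S (p' * q)) \<le> ord_in S (p * q' + p' * q)"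
    using ord_in_add[OF num] .
  then show ?thesis
    unfolding sum using 1 2 num by (auto simp: val_Fract ord_in_mult)
qed

lemma val_one [simp]: "val S 1 = 0"
  using val_mult[of 1 1 S] by simp

lemma val_power: "z \<noteq> 0 \<Longrightarrow> val S (z ^ n) = int n * val S z"
  by (induction n) (simp_all add: val_mult algebra_simps)

lemma val_inverse: "z \<noteq> 0 \<Longrightarrow> val S (inverse z) = - val S z"
  using val_mult[of z "inverse z" S] by simp

lemma val_divide: "z \<noteq> 0 \<Longrightarrow> w \<noteq> 0 \<Longrightarrow> val S (z / w) = val S z - val S w"
  by (simp add: divide_inverse val_mult val_inverse)

lemma val_minus_one: "val S (- 1) = 0"
  using val_mult[of "- 1" "- 1" S] by simp

lemma val_bounded:
  assumes "z \<noteq> 0"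
  shows "\<exists>N::nat. \<forall>S. val S z \<le> int N"
proof -
  obtain p q where 1: "p \<noteq> 0" "q \<noteq> 0" "z = Fract p q"
    using fract_nonzero_cases[OF assms] .
  obtain N where N: "\<forall>S. ord_in S p \<le> N"
    using ord_in_bounded[OF 1(1)] ..
  then have "val S z \<le> int N" for S
    unfolding 1(3) val_Fract[OF 1(1,2)] using N[rule_format, of S] by linarith
  then show ?thesis by blast
qed

text \<open>
  The maximal ideal and the valuation ring of \<open>val S\<close>, and the subfield of the rational functions in the
  indeterminates of \<open>S\<close>. The valuation \<open>val S\<close> is trivial on the subfield \<open>fractions_over (- S)\<close>, so that
  this subfield embeds into the residue field: being equal up to an infinitesimal is a way of
  specializing a rational function to a value in the subfield.
\<close>

definition infinitesimals :: "('v::linorder) set \<Rightarrow> 'v mpoly fract set" where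
  "infinitesimals S = {z. z = 0 \<or> 0 < val S z}"

definition integers_at :: "('v::linorder) set \<Rightarrow> 'v mpoly fract set" where
  "integers_at S = {z. z = 0 \<or> 0 \<le> val S z}"

definition fractions_over :: "('v::linorder) set \<Rightarrow> 'v mpoly fract set" where
  "fractions_over S = {Fract p q | p q. p \<in> polys_over S \<and> q \<in> polys_over S \<and> q \<noteq> 0}"

lemma infinitesimals_zero [simp]: "0 \<in> infinitesimals S"
  by (simp add: infinitesimals_def)

lemma infinitesimals_add:
  "z \<in> infinitesimals S \<Longrightarrow> w \<in> infinitesimals S \<Longrightarrow> z + w \<in> infinitesimals S"
  unfolding infinitesimals_def using val_add[of z w S] by fastforce

lemma infinitesimals_mult:
  "z \<in> infinitesimals S \<Longrightarrow> w \<in> integers_at S \<Longrightarrow> z * w \<in> infinitesimals S"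
  unfolding infinitesimals_def integers_at_def using val_mult[of z w S] by fastforce

lemma infinitesimals_uminus: "z \<in> infinitesimals S \<Longrightarrow> - z \<in> infinitesimals S"
  using infinitesimals_mult[of z S "- 1"] by (simp add: integers_at_def val_minus_one)

lemma infinitesimals_diff:
  "z \<in> infinitesimals S \<Longrightarrow> w \<in> infinitesimals S \<Longrightarrow> z - w \<in> infinitesimals S"
  using infinitesimals_add[of z S "- w"] by (simp add: infinitesimals_uminus)

lemma val_fractions_over:
  assumes "z \<in> fractions_over (- S)" "z \<noteq> 0"
  shows "val S z = 0"
proof -
  obtain p q where *: "p \<in> polys_over (- S)" "q \<in> polys_over (- S)" "q \<noteq> 0" "z = Fract p q"
    using assms(1) unfolding fractions_over_def by blast
  then have "p \<noteq> 0"
    using assms by (auto simp: fract_collapse)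
  then show ?thesis
    using * by (simp add: val_Fract ord_in_polys_over)
qed

lemma fractions_over_integers: "z \<in> fractions_over (- S) \<Longrightarrow> z \<in> integers_at S"
  using val_fractions_over by (fastforce simp: integers_at_def)

lemma fractions_over_infinitesimal:
  "z \<in> fractions_over (- S) \<Longrightarrow> z \<in> infinitesimals S \<Longrightarrow> z = 0"
  using val_fractions_over by (fastforce simp: infinitesimals_def)

lemma fractions_overI:
  "p \<in> polys_over S \<Longrightarrow> q \<in> polys_over S \<Longrightarrow> q \<noteq> 0 \<Longrightarrow> Fract p q \<in> fractions_over S"
  by (auto simp: fractions_over_def)

lemma fractions_over_add:
  assumes "z \<in> fractions_over S" "w \<in> fractions_over S"
  shows "z + w \<in> fractions_over S"
proof -
  obtain p q p' q' where
    "p \<in> polys_over S" "q \<in> polys_over S" "q \<noteq> 0" "z = Fract p q"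
    "p' \<in> polys_over S" "q' \<in> polys_over S" "q' \<noteq> 0" "w = Fract p' q'"
    using assms unfolding fractions_over_def by blast
  then show ?thesis
    by (auto intro!: fractions_overI polys_over_add polys_over_mult)
qed

lemma fractions_over_mult:
  assumes "z \<in> fractions_over S" "w \<in> fractions_over S"
  shows "z * w \<in> fractions_over S"
proof -
  obtain p q p' q' where
    "p \<in> polys_over S" "q \<in> polys_over S" "q \<noteq> 0" "z = Fract p q"
    "p' \<in> polys_over S" "q' \<in> polys_over S" "q' \<noteq> 0" "w = Fract p' q'"
    using assms unfolding fractions_over_def by blast
  then show ?thesis
    by (auto intro!: fractions_overI polys_over_mult)
qed

lemma fractions_over_zero [simp]: "0 \<in> fractions_over S"
  unfolding Zero_fract_def by (rule fractions_overI) (simp_all add: polys_over_def)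

lemma fractions_over_one [simp]: "1 \<in> fractions_over S"
  unfolding One_fract_def by (rule fractions_overI) simp_all

lemma fractions_over_uminus: "z \<in> fractions_over S \<Longrightarrow> - z \<in> fractions_over S"
  unfolding fractions_over_def by clarify (metis minus_fract polys_over_uminus)

lemma fractions_over_power: "z \<in> fractions_over S \<Longrightarrow> z ^ n \<in> fractions_over S"
  by (induction n) (simp_all add: fractions_over_mult)

lemma fractions_over_of_nat: "of_nat n \<in> fractions_over S"
  by (induction n) (simp_all add: fractions_over_add)

lemma fractions_over_inverse:
  assumes "z \<in> fractions_over S"
  shows "inverse z \<in> fractions_over S"
proof (cases "z = 0")
  case False
  obtain p q where *: "p \<in> polys_over S" "q \<in> polys_over S" "q \<noteq> 0" "z = Fract p q"
    using assms unfolding fractions_over_def by blast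
  then have "p \<noteq> 0"
    using False by (auto simp: fract_collapse)
  then show ?thesis
    using * by (simp add: fractions_overI)
qed simp

lemma fractions_over_divide:
  "z \<in> fractions_over S \<Longrightarrow> w \<in> fractions_over S \<Longrightarrow> z / w \<in> fractions_over S"
  by (simp add: divide_inverse fractions_over_mult fractions_over_inverse)

definition indet_fract :: "('v::linorder) \<Rightarrow> 'v mpoly fract" where
  "indet_fract v = Fract (Poly_Mapping.single (Poly_Mapping.single v 1) 1) 1"

lemma indet_fract_nonzero: "indet_fract v \<noteq> 0"
proof -
  have "Poly_Mapping.single (Poly_Mapping.single v 1) (1::rat) \<noteq> 0"
    by (metis lookup_single_eq lookup_zero zero_neq_one)
  then show ?thesis
    by (simp add: indet_fract_def Zero_fract_def eq_fract del: One_nat_def)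
qed

lemma indet_fract_over: "v \<in> S \<Longrightarrow> indet_fract v \<in> fractions_over S"
  unfolding indet_fract_def by (intro fractions_overI polys_over_single) auto

lemma indet_fract_infinitesimal:
  assumes "v \<in> S"
  shows "indet_fract v \<in> infinitesimals S"
proof -
  let ?p = "Poly_Mapping.single (Poly_Mapping.single v (1::nat)) (1::rat)"
  have "?p \<noteq> 0"
    by (metis lookup_single_eq lookup_zero zero_neq_one)
  moreover have "ord_in S ?p = 1"
    using assms by (simp add: ord_in_def degree_in_def)
  moreover have "ord_in S (1 :: 'a mpoly) = 0"
    by (simp add: ord_in_def)
  ultimately show ?thesis
    by (simp add: infinitesimals_def indet_fract_def val_Fract del: One_nat_def)
qed

lemma of_nat_fract_eq_iff: "(of_nat m :: ('v::linorder) mpoly fract) = of_nat n \<longleftrightarrow> m = n"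
  by (simp add: of_nat_fract eq_fract)

section \<open>The subbasic sets of the two topologies\<close>

lemma openin_patch_V:
  assumes "X \<subseteq> UNIV - {top_class.top}"
  shows "openin (patch_topology X) (V X a)"
proof -
  have "V X a = V X a \<inter> (X - V X top_class.top)"
    using assms by (auto simp: V_def top_unique)
  then show ?thesis
    unfolding patch_topology_def by (intro topology_generated_by_Basis) blast
qed

lemma openin_patch_compl_V: "openin (patch_topology X) (X - V X a)"
proof -
  have "X - V X a = V X bot_class.bot \<inter> (X - V X a)"
    by (auto simp: V_def)
  then show ?thesis
    unfolding patch_topology_def by (intro topology_generated_by_Basis) blast
qed

lemma closedin_zariski_V:
  assumes "X \<subseteq> UNIV - {top_class.top}"
  shows "closedin (zariski_cl X) (V X a)"
proof -
  have "openin (zariski_cl X) (X - V X a)"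
    unfolding zariski_cl_def by (intro topology_generated_by_Basis) blast
  then show ?thesis
    by (simp add: closedin_def topspace_zariski_cl[OF assms]) (auto simp: V_def)
qed

section \<open>Sections over the space\<close>

definition lower_indets :: "'a::order \<Rightarrow> 'a indet set" where
  "lower_indets y = {v. index v \<le> y}"

text \<open>
  The ring whose spectrum will be \<open>X\<close>. The value of a section at \<open>x\<close> is a rational function in those
  indeterminates \<open>T\<^sub>a\<close> for which the open set \<open>X - V X a\<close> contains \<open>x\<close>. A point \<open>y\<close> with \<open>x \<le> y\<close> is a
  specialization of \<open>x\<close>; going from \<open>x\<close> to \<open>y\<close>, some of these indeterminates disappear, and the value at
  \<open>y\<close> has to be the specialization of the value at \<open>x\<close> when they tend to zero. The last condition is
  continuity for the patch topology and the discrete topology on the field.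
\<close>

definition sections :: "'a::complete_lattice set \<Rightarrow> ('a \<Rightarrow> 'a indet mpoly fract) set" where
  "sections X = {f.
     (\<forall>x. x \<notin> X \<longrightarrow> f x = 0) \<and>
     (\<forall>x\<in>X. f x \<in> fractions_over (- lower_indets x)) \<and>
     (\<forall>x\<in>X. \<forall>y\<in>X. x \<le> y \<longrightarrow> f x - f y \<in> infinitesimals (lower_indets y)) \<and>
     (\<forall>c. openin (patch_topology X) {x \<in> X. f x = c})}"

lemma sectionsI:
  assumes "\<And>x. x \<notin> X \<Longrightarrow> f x = 0"
    and "\<And>x. x \<in> X \<Longrightarrow> f x \<in> fractions_over (- lower_indets x)"
    and "\<And>x y. x \<in> X \<Longrightarrow> y \<in> X \<Longrightarrow> x \<le> y \<Longrightarrow> f x - f y \<in> infinitesimals (lower_indets y)"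
    and "\<And>c. openin (patch_topology X) {x \<in> X. f x = c}"
  shows "f \<in> sections X"
  using assms by (simp add: sections_def)

lemma sectionsD:
  assumes "f \<in> sections X"
  shows "x \<notin> X \<Longrightarrow> f x = 0"
    and "x \<in> X \<Longrightarrow> f x \<in> fractions_over (- lower_indets x)"
    and "x \<in> X \<Longrightarrow> y \<in> X \<Longrightarrow> x \<le> y \<Longrightarrow> f x - f y \<in> infinitesimals (lower_indets y)"
    and "openin (patch_topology X) {x \<in> X. f x = c}"
  using assms by (simp_all add: sections_def)

lemma section_integer:
  assumes "f \<in> sections X" "x \<in> X" "y \<in> X" "x \<le> y"
  shows "f x \<in> integers_at (lower_indets y)"
proof (cases "f x = f y")
  case True
  then show ?thesis
    using sectionsD(2)[OF assms(1,3)] fractions_over_integers by metis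
next
  case False
  have 1: "f x - f y \<in> infinitesimals (lower_indets y)"
    by (rule sectionsD(3)[OF assms])
  have 2: "f y \<in> integers_at (lower_indets y)"
    using sectionsD(2)[OF assms(1,3)] by (rule fractions_over_integers)
  show ?thesis
    using val_add[of "f x - f y" "f y" "lower_indets y"] 1 2 False
    unfolding integers_at_def infinitesimals_def by fastforce
qed

text \<open>
  The value at \<open>y\<close> is the residue of the value at \<open>x\<close>, so a nonzero residue forces a unit of the
  valuation ring. In particular the zeros of a section are closed under specialization.
\<close>

lemma section_unit:
  assumes "f \<in> sections X" "x \<in> X" "y \<in> X" "x \<le> y" "f y \<noteq> 0"
  shows "f x \<noteq> 0" "val (lower_indets y) (f x) = 0"
proof -
  have y: "f y \<in> fractions_over (- lower_indets y)"
    using sectionsD(2)[OF assms(1,3)] .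
  have diff: "f x - f y \<in> infinitesimals (lower_indets y)"
    by (rule sectionsD(3)[OF assms(1-4)])
  have "f x \<notin> infinitesimals (lower_indets y)"
  proof
    assume "f x \<in> infinitesimals (lower_indets y)"
    then have "f x - (f x - f y) \<in> infinitesimals (lower_indets y)"
      using diff by (rule infinitesimals_diff)
    then show False
      using fractions_over_infinitesimal[OF y] assms(5) by simp
  qed
  then show "f x \<noteq> 0" "val (lower_indets y) (f x) = 0"
    using section_integer[OF assms(1-4)] by (auto simp: infinitesimals_def integers_at_def)
qed

lemma openin_fibre_combine:
  assumes "\<And>a. openin T {x \<in> X. f x = a}" "\<And>b. openin T {x \<in> X. g x = b}"
  shows "openin T {x \<in> X. F (f x) (g x) = c}"
proof -
  have "{x \<in> X. F (f x) (g x) = c} =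
      \<Union>{{x \<in> X. f x = a} \<inter> {x \<in> X. g x = b} | a b. F a b = c}"
    by blast
  also have "openin T \<dots>"
    using assms by (intro openin_Union) auto
  finally show ?thesis .
qed

lemma section_add:
  assumes f: "f \<in> sections X" and g: "g \<in> sections X"
  shows "(\<lambda>x. f x + g x) \<in> sections X"
proof (rule sectionsI)
  fix x y assume xy: "x \<in> X" "y \<in> X" "x \<le> y"
  show "f x + g x - (f y + g y) \<in> infinitesimals (lower_indets y)"
    using infinitesimals_add[OF sectionsD(3)[OF f xy] sectionsD(3)[OF g xy]]
    by (simp add: algebra_simps)
qed (simp_all add: sectionsD[OF f] sectionsD[OF g] fractions_over_add
    openin_fibre_combine[where F = "\<lambda>a b. a + b"])

lemma section_mult:
  assumes f: "f \<in> sections X" and g: "g \<in> sections X"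
  shows "(\<lambda>x. f x * g x) \<in> sections X"
proof (rule sectionsI)
  fix x y assume xy: "x \<in> X" "y \<in> X" "x \<le> y"
  have "(f x - f y) * g x \<in> infinitesimals (lower_indets y)"
    by (intro infinitesimals_mult sectionsD(3)[OF f xy] section_integer[OF g xy])
  moreover have "(g x - g y) * f y \<in> infinitesimals (lower_indets y)"
    by (intro infinitesimals_mult sectionsD(3)[OF g xy] section_integer[OF f xy(2,2)] order_refl)
  ultimately have "(f x - f y) * g x + (g x - g y) * f y \<in> infinitesimals (lower_indets y)"
    by (rule infinitesimals_add)
  then show "f x * g x - f y * g y \<in> infinitesimals (lower_indets y)"
    by (simp add: algebra_simps)
qed (simp_all add: sectionsD[OF f] sectionsD[OF g] fractions_over_mult
    openin_fibre_combine[where F = "\<lambda>a b. a * b"])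

lemma section_uminus:
  assumes f: "f \<in> sections X"
  shows "(\<lambda>x. - f x) \<in> sections X"
proof (rule sectionsI)
  fix x y assume xy: "x \<in> X" "y \<in> X" "x \<le> y"
  show "- f x - - f y \<in> infinitesimals (lower_indets y)"
    using infinitesimals_uminus[OF sectionsD(3)[OF f xy]] by simp
qed (simp_all add: sectionsD[OF f] fractions_over_uminus
    openin_fibre_combine[where F = "\<lambda>a b. - a" and g = f])

text \<open>
  The section \<open>indet_section X a\<close> is nonzero exactly on \<open>X - V X a\<close>; these sections ensure that every open
  set of \<open>X\<close> comes from an open set of the spectrum. The constants supply infinitely many coefficients
  for linear combinations.
\<close>

definition const_section :: "'a::complete_lattice set \<Rightarrow> nat \<Rightarrow> 'a \<Rightarrow> 'a indet mpoly fract" where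
  "const_section X n x = (if x \<in> X then of_nat n else 0)"

definition indet_section :: "'a::complete_lattice set \<Rightarrow> 'a \<Rightarrow> 'a \<Rightarrow> 'a indet mpoly fract" where
  "indet_section X a x = (if x \<in> X - V X a then indet_fract (Indet a) else 0)"

lemma const_section:
  assumes "X \<subseteq> UNIV - {top_class.top}"
  shows "const_section X n \<in> sections X"
proof (rule sectionsI)
  fix c
  have "{x \<in> X. const_section X n x = c} = (if c = of_nat n then X else {})"
    by (auto simp: const_section_def)
  then show "openin (patch_topology X) {x \<in> X. const_section X n x = c}"
    using openin_topspace[of "patch_topology X"] by (simp add: topspace_patch_topology[OF assms])
qed (simp_all add: const_section_def fractions_over_of_nat)

lemma zero_section:
  assumes "X \<subseteq> UNIV - {top_class.top}"
  shows "(\<lambda>x. 0) \<in> sections X"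
  using const_section[OF assms, of 0] by (simp add: const_section_def[abs_def] cong: if_cong)

lemma indet_section:
  assumes "X \<subseteq> UNIV - {top_class.top}"
  shows "indet_section X a \<in> sections X"
proof (rule sectionsI)
  fix c
  have "{x \<in> X. indet_section X a x = c} =
      (if c = indet_fract (Indet a) then X - V X a else if c = 0 then V X a else {})"
    using indet_fract_nonzero[of "Indet a"] by (auto simp: indet_section_def V_def)
  then show "openin (patch_topology X) {x \<in> X. indet_section X a x = c}"
    by (simp add: openin_patch_V[OF assms] openin_patch_compl_V)
next
  fix x y assume xy: "x \<in> X" "y \<in> X" "x \<le> y"
  have "Indet a \<in> lower_indets y" if "y \<in> V X a"
    using that by (simp add: lower_indets_def V_def)
  then show "indet_section X a x - indet_section X a y \<in> infinitesimals (lower_indets y)"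
    using xy order_trans[of a x y] indet_fract_infinitesimal
    by (auto simp: indet_section_def V_def)
qed (auto simp: indet_section_def V_def lower_indets_def intro: indet_fract_over)

section \<open>Prime ideals of the ring of sections\<close>

locale patch_compact =
  fixes X :: "'a::complete_lattice set"
  assumes X: "X \<subseteq> UNIV - {top_class.top}"
    and compact: "compact_space (patch_topology X)"
begin

lemma finite_section_values:
  assumes "f \<in> sections X"
  shows "finite (f ` X)"
proof -
  have "compactin (patch_topology X) X"
    using compact by (simp add: compact_space_def topspace_patch_topology[OF X])
  then obtain \<F> where \<F>: "finite \<F>" "\<F> \<subseteq> range (\<lambda>c. {x \<in> X. f x = c})" "X \<subseteq> \<Union>\<F>"
    using compactinD[of "patch_topology X" X "range (\<lambda>c. {x \<in> X. f x = c})"]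
      sectionsD(4)[OF assms] by blast
  have "finite (f ` A)" if A: "A \<in> \<F>" for A
  proof -
    obtain c where "A = {x \<in> X. f x = c}"
      using A \<F>(2) by blast
    then have "f ` A \<subseteq> {c}"
      by blast
    then show ?thesis
      by (rule finite_subset) simp
  qed
  then have "finite (\<Union>A\<in>\<F>. f ` A)"
    using \<F>(1) by simp
  then show ?thesis
    by (rule finite_subset[rotated]) (use \<F>(3) in blast)
qed

lemma section_values_bounded:
  assumes "f \<in> sections X"
  obtains N :: nat where "\<And>x S. x \<in> X \<Longrightarrow> f x \<noteq> 0 \<Longrightarrow> val S (f x) \<le> int N"
proof -
  have "\<forall>z\<in>f ` X - {0}. \<exists>N::nat. \<forall>S. val S z \<le> int N"
    using val_bounded by blast
  then obtain B :: "'a indet mpoly fract \<Rightarrow> nat"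
    where B: "\<And>z S. z \<in> f ` X - {0} \<Longrightarrow> val S z \<le> int (B z)"
    by metis
  have "val S (f x) \<le> int (Max (B ` (f ` X)))" if "x \<in> X" "f x \<noteq> 0" for x S
  proof -
    have "B (f x) \<le> Max (B ` (f ` X))"
      using that finite_section_values[OF assms] by (intro Max_ge) auto
    then show ?thesis
      using B[of "f x" S] that by force
  qed
  then show ?thesis
    using that by blast
qed

text \<open>
  This is the reason for working with valuations in the integers: if \<open>g\<close> vanishes wherever \<open>f\<close> does,
  then \<open>f\<close> divides a power of \<open>g\<close>. The quotient \<open>g ^ n / f\<close>, with value zero where \<open>f\<close> vanishes, specializes
  correctly where \<open>f\<close> keeps a nonzero value. Where \<open>f\<close> is specialized to zero, so is \<open>g\<close>; then
  \<open>g x\<close> is zero or has a valuation of at least one, and the quotient is infinitesimal as soon as \<open>n\<close> exceeds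
  all valuations of all nonzero values of \<open>f\<close>. Such an \<open>n\<close> exists because \<open>f\<close> takes only finitely many values
  and the valuations of each of them are bounded above.
\<close>

lemma section_quotient:
  assumes f: "f \<in> sections X" and g: "g \<in> sections X"
    and zeros: "\<And>x. x \<in> X \<Longrightarrow> f x = 0 \<Longrightarrow> g x = 0"
  obtains n where "(\<lambda>x. g x ^ n / f x) \<in> sections X" "0 < n"
proof -
  obtain N :: nat where N: "\<And>x S. x \<in> X \<Longrightarrow> f x \<noteq> 0 \<Longrightarrow> val S (f x) \<le> int N"
    using section_values_bounded[OF f] by blast
  let ?n = "Suc N"
  have "(\<lambda>x. g x ^ ?n / f x) \<in> sections X"
  proof (rule sectionsI)
    fix x y assume xy: "x \<in> X" "y \<in> X" "x \<le> y"
    let ?S = "lower_indets y"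
    have pow: "g x ^ k - g y ^ k \<in> infinitesimals ?S \<and> g x ^ k \<in> integers_at ?S" for k
    proof (induction k)
      case (Suc k)
      have gy: "g y \<in> integers_at ?S" and gx: "g x \<in> integers_at ?S"
        using section_integer[OF g] xy by auto
      have "(g x ^ k - g y ^ k) * g y \<in> infinitesimals ?S"
        using Suc gy by (blast intro: infinitesimals_mult)
      moreover have "(g x - g y) * g x ^ k \<in> infinitesimals ?S"
        using Suc sectionsD(3)[OF g xy] by (blast intro: infinitesimals_mult)
      ultimately have "(g x ^ k - g y ^ k) * g y + (g x - g y) * g x ^ k \<in> infinitesimals ?S"
        by (rule infinitesimals_add)
      moreover have "g x ^ Suc k \<in> integers_at ?S"
        using Suc gx by (auto simp: integers_at_def val_mult)
      ultimately show ?case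
        by (simp add: algebra_simps)
    qed (simp add: integers_at_def)
    show "g x ^ ?n / f x - g y ^ ?n / f y \<in> infinitesimals ?S"
    proof (cases "f y = 0")
      case False
      note fx = section_unit[OF f xy False]
      have fy: "val ?S (f y) = 0"
        using section_unit(2)[OF f xy(2,2) order_refl False] .
      \<comment> \<open>Over the denominator \<open>f x * f y\<close> the difference splits into a multiple of \<open>g x ^ ?n - g y ^ ?n\<close> and
        a multiple of \<open>f x - f y\<close>; both cofactors lie in the valuation ring because \<open>f x\<close> and \<open>f y\<close> are units.\<close>
      have "(g x ^ ?n - g y ^ ?n) * inverse (f x) \<in> infinitesimals ?S"
        using pow[of ?n] fx by (intro infinitesimals_mult) (simp_all add: integers_at_def val_inverse)
      moreover have "- (f x - f y) * (g y ^ ?n * inverse (f x) * inverse (f y)) \<in> infinitesimals ?S"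
      proof (intro infinitesimals_mult infinitesimals_uminus sectionsD(3)[OF f xy])
        have "g y ^ ?n \<in> integers_at ?S"
          by (intro fractions_over_integers fractions_over_power sectionsD(2)[OF g xy(2)])
        then show "g y ^ ?n * inverse (f x) * inverse (f y) \<in> integers_at ?S"
          using fx fy False by (auto simp: integers_at_def val_inverse val_mult)
      qed
      ultimately have "(g x ^ ?n - g y ^ ?n) * inverse (f x) +
          - (f x - f y) * (g y ^ ?n * inverse (f x) * inverse (f y)) \<in> infinitesimals ?S"
        by (rule infinitesimals_add)
      also have "(g x ^ ?n - g y ^ ?n) * inverse (f x) +
          - (f x - f y) * (g y ^ ?n * inverse (f x) * inverse (f y)) = g x ^ ?n / f x - g y ^ ?n / f y"
        using fx(1) False by (simp add: field_simps del: power_Suc)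
      finally show ?thesis .
    next
      case True
      have gy: "g y = 0"
        using zeros xy(2) True by blast
      show ?thesis
      proof (cases "f x = 0 \<or> g x = 0")
        case False
        have "g x \<in> infinitesimals ?S"
          using sectionsD(3)[OF g xy] gy by simp
        then have "1 \<le> val ?S (g x)"
          using False by (simp add: infinitesimals_def)
        then have "int ?n \<le> int ?n * val ?S (g x)"
          by (simp add: mult_le_cancel_left1)
        moreover have "val ?S (f x) \<le> int N"
          using N xy(1) False by blast
        moreover have "val ?S (g x ^ ?n / f x) = int ?n * val ?S (g x) - val ?S (f x)"
          using False by (simp add: val_divide val_power del: power_Suc of_nat_Suc)
        ultimately have "0 < val ?S (g x ^ ?n / f x)"
          by linarith
        then show ?thesis
          using True by (simp add: infinitesimals_def)
      qed (use True in auto)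
    qed
  qed (simp_all add: sectionsD[OF f] sectionsD[OF g] fractions_over_divide fractions_over_power
      openin_fibre_combine[where F = "\<lambda>a b. a ^ Suc N / b"] del: power_Suc)
  then show ?thesis
    using that by blast
qed

text \<open>
  For each pair of values of \<open>f\<close> and \<open>g\<close> at most one coefficient \<open>n\<close> causes an accidental cancellation, and
  there are only finitely many pairs of values. Hence the common zeros of finitely many elements of an
  ideal are the zeros of one element of it.
\<close>

lemma section_common_zeros:
  assumes f: "f \<in> sections X" and g: "g \<in> sections X"
  obtains n where "\<And>x. x \<in> X \<Longrightarrow> f x + of_nat n * g x = 0 \<longleftrightarrow> f x = 0 \<and> g x = 0"
proof -
  let ?bad = "\<lambda>a b. {n. a + of_nat n * b = 0 \<and> b \<noteq> 0}"
  have "finite (?bad a b)" for a b :: "'a indet mpoly fract"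
  proof (cases "?bad a b = {}")
    case False
    then obtain m where "a + of_nat m * b = 0" "b \<noteq> 0"
      by blast
    then have "?bad a b \<subseteq> {m}"
      by (auto simp: add_eq_0_iff) (metis mult_right_cancel of_nat_fract_eq_iff)
    then show ?thesis
      by (rule finite_subset) simp
  qed (simp only: finite.emptyI)
  then have "finite (\<Union>a\<in>f ` X. \<Union>b\<in>g ` X. ?bad a b)"
    using finite_section_values f g by blast
  then obtain n where "n \<notin> (\<Union>a\<in>f ` X. \<Union>b\<in>g ` X. ?bad a b)"
    using ex_new_if_finite[OF infinite_UNIV_nat] by blast
  then show ?thesis
    using that[of n] by fastforce
qed

text \<open>
  The set of zeros is patch-closed, hence patch-compact, and it contains with every point \<open>z\<close> the patch-open
  set \<open>V X z\<close> of its specializations. So it is a finite union of sets \<open>V X z\<close>.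
\<close>

lemma closedin_zeros:
  assumes f: "f \<in> sections X"
  shows "closedin (zariski_cl X) {x \<in> X. f x = 0}"
proof -
  let ?Z = "{x \<in> X. f x = 0}"
  have "X - ?Z = \<Union>{{x \<in> X. f x = c} | c. c \<noteq> 0}"
    by blast
  also have "openin (patch_topology X) \<dots>"
    using sectionsD(4)[OF f] by (intro openin_Union) auto
  finally have "closedin (patch_topology X) ?Z"
    by (auto simp: closedin_def topspace_patch_topology[OF X])
  then have "compactin (patch_topology X) ?Z"
    by (rule closedin_compact_space[OF compact])
  moreover have "?Z \<subseteq> \<Union>(V X ` ?Z)"
    by (auto simp: V_def)
  ultimately obtain \<F> where \<F>: "finite \<F>" "\<F> \<subseteq> V X ` ?Z" "?Z \<subseteq> \<Union>\<F>"
    using compactinD[of "patch_topology X" ?Z "V X ` ?Z"] openin_patch_V[OF X] by blast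
  have "V X z \<subseteq> ?Z" if "z \<in> ?Z" for z
    using section_unit(1)[OF f] that by (fastforce simp: V_def)
  then have "?Z = \<Union>\<F>"
    using \<F> by blast
  then show ?thesis
    using \<F>(1,2) closedin_zariski_V[OF X] by (metis (no_types, lifting) closedin_Union image_iff subsetD)
qed

text \<open>
  A point \<open>x\<close> that induces the prime ideal \<open>P\<close> is a common zero of all \<open>f \<in> P\<close> at which no \<open>g \<notin> P\<close> vanishes.
  The conditions for one pair \<open>f\<close>, \<open>g\<close> define a patch-closed set. These sets are closed under finite
  intersections by primality and \<open>section_common_zeros\<close>, and none is empty: otherwise \<open>g\<close> would vanish
  wherever \<open>f\<close> does, and \<open>section_quotient\<close> would put a power of \<open>g\<close> into \<open>P\<close>. Compactness gives \<open>x\<close>.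
\<close>

lemma prime_is_point:
  assumes P: "P \<subseteq> sections X"
    and zero: "(\<lambda>x. 0) \<in> P"
    and one: "const_section X 1 \<notin> P"
    and add: "\<And>f g. f \<in> P \<Longrightarrow> g \<in> P \<Longrightarrow> (\<lambda>x. f x + g x) \<in> P"
    and mult: "\<And>f g. f \<in> P \<Longrightarrow> g \<in> sections X \<Longrightarrow> (\<lambda>x. g x * f x) \<in> P"
    and prime: "\<And>f g. f \<in> sections X \<Longrightarrow> g \<in> sections X \<Longrightarrow> (\<lambda>x. f x * g x) \<in> P \<Longrightarrow> f \<in> P \<or> g \<in> P"
  obtains x where "x \<in> X" "P = {f \<in> sections X. f x = 0}"
proof -
  let ?C = "\<lambda>f g. {x \<in> X. f x = 0 \<and> g x \<noteq> 0}"
  define \<C> where "\<C> = {?C f g | f g. f \<in> P \<and> g \<in> sections X - P}"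
  have \<C>I: "?C f g \<in> \<C>" if "f \<in> P" "g \<in> sections X - P" for f g
    unfolding \<C>_def using that by (intro CollectI exI conjI) (rule refl)
  have one': "const_section X 1 \<in> sections X - P"
    using one const_section[OF X] by blast
  have power: "g \<in> P" if "g \<in> sections X" "(\<lambda>x. g x ^ n) \<in> P" "0 < n" for g n
    using that(3,2)
  proof (induction n)
    case (Suc n)
    have "(\<lambda>x. g x ^ n) \<in> sections X" if "0 < n"
      using that
    proof (induction n)
      case (Suc n)
      then show ?case
        using section_mult[OF \<open>g \<in> sections X\<close>, of "\<lambda>x. g x ^ n"] \<open>g \<in> sections X\<close>
        by (cases "n = 0") simp_all
    qed simp
    then show ?case
      using Suc prime[of g "\<lambda>x. g x ^ n"] \<open>g \<in> sections X\<close> by (cases "n = 0") auto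
  qed simp
  have nonempty: "C \<noteq> {}" if "C \<in> \<C>" for C
  proof
    assume "C = {}"
    then obtain f g where fg: "f \<in> P" "g \<in> sections X" "g \<notin> P" "?C f g = {}"
      using \<open>C \<in> \<C>\<close> unfolding \<C>_def by blast
    then have f: "f \<in> sections X"
      using P by blast
    have zeros: "g x = 0" if "x \<in> X" "f x = 0" for x
      using fg(4) that by blast
    obtain n where n: "(\<lambda>x. g x ^ n / f x) \<in> sections X" "0 < n"
      using section_quotient[OF f fg(2)] zeros by blast
    have "g x ^ n / f x * f x = g x ^ n" for x
      using zeros[of x] n(2) sectionsD(1)[OF f, of x] sectionsD(1)[OF fg(2), of x]
      by (cases "x \<in> X"; cases "f x = 0") auto
    then have "(\<lambda>x. g x ^ n) \<in> P"
      using mult[OF fg(1) n(1)] by simp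
    then show False
      using power fg(2,3) n(2) by blast
  qed
  have inter: "C \<inter> D \<in> \<C>" if CD: "C \<in> \<C>" "D \<in> \<C>" for C D
  proof -
    obtain f g where 1: "f \<in> P" "g \<in> sections X" "g \<notin> P" "C = ?C f g"
      using CD(1) unfolding \<C>_def by blast
    obtain f' g' where 2: "f' \<in> P" "g' \<in> sections X" "g' \<notin> P" "D = ?C f' g'"
      using CD(2) unfolding \<C>_def by blast
    obtain n where n: "\<And>x. x \<in> X \<Longrightarrow> f x + of_nat n * f' x = 0 \<longleftrightarrow> f x = 0 \<and> f' x = 0"
      using section_common_zeros[of f f'] 1 2 P by blast
    have sum: "(\<lambda>x. f x + const_section X n x * f' x) \<in> P"
      by (intro add mult 1 2 const_section[OF X])
    have prod: "(\<lambda>x. g x * g' x) \<in> sections X - P"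
      using section_mult[OF 1(2) 2(2)] prime[OF 1(2) 2(2)] 1(3) 2(3) by blast
    have "C \<inter> D = ?C (\<lambda>x. f x + const_section X n x * f' x) (\<lambda>x. g x * g' x)"
      unfolding 1 2 using n by (auto simp: const_section_def)
    then show ?thesis
      by (simp only: \<C>I[OF sum prod])
  qed
  have closed: "closedin (patch_topology X) C" if C: "C \<in> \<C>" for C
  proof -
    obtain f g where fg: "f \<in> P" "g \<in> sections X" "C = ?C f g"
      using C unfolding \<C>_def by blast
    have "X - C = {x \<in> X. (f x = 0 \<and> g x \<noteq> 0) = False}"
      using fg by blast
    also have "openin (patch_topology X) \<dots>"
      using P fg by (intro openin_fibre_combine[where F = "\<lambda>a b. a = 0 \<and> b \<noteq> 0"] sectionsD(4)) blast+
    finally show ?thesis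
      using fg(3) by (auto simp: closedin_def topspace_patch_topology[OF X])
  qed
  have "\<Inter>\<F> \<noteq> {}" if "finite \<F>" "\<F> \<subseteq> \<C>" for \<F>
  proof (cases "\<F> = {}")
    case False
    have "\<Inter>\<F> \<in> \<C>"
      using that(1) False that(2)
    proof (induction rule: finite_ne_induct)
      case (insert C \<F>)
      then show ?case using inter by simp
    qed simp
    then show ?thesis by (rule nonempty)
  qed simp
  then have "\<Inter>\<C> \<noteq> {}"
    using compact_space_fip[THEN iffD1, OF compact, rule_format, of \<C>] closed by metis
  then obtain x where "x \<in> \<Inter>\<C>"
    by blast
  then have x: "x \<in> ?C f g" if "f \<in> P" "g \<in> sections X - P" for f g
    using \<C>I[OF that] by blast
  show ?thesis
  proof
    show "x \<in> X"
      using x[OF zero one'] by simp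
    show "P = {f \<in> sections X. f x = 0}"
      using x[OF _ one'] x[OF zero] P by blast
  qed
qed

end

section \<open>Coding functions as sets of sets\<close>

lemma inj_prod_nat_sum: "\<exists>J :: 'a \<times> nat \<Rightarrow> 'a + nat. inj J"
proof -
  have inf: "infinite (UNIV :: ('a + nat) set)"
    by (simp add: finite_Plus_UNIV_iff)
  have inj: "inj (map_prod (Inl :: 'a \<Rightarrow> 'a + nat) (Inr :: nat \<Rightarrow> 'a + nat))"
    by (simp add: prod.inj_map)
  obtain f :: "('a + nat) \<times> ('a + nat) \<Rightarrow> 'a + nat" where "bij_betw f (UNIV \<times> UNIV) UNIV"
    using card_of_Times_same_infinite[OF inf] unfolding card_of_ordIso[symmetric] by auto
  then have "inj f"
    by (simp add: bij_betw_def)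
  then show ?thesis
    using inj_compose inj by blast
qed

definition graph_code :: "('a \<times> nat \<Rightarrow> 'b) \<Rightarrow> ('a \<Rightarrow> nat) \<Rightarrow> 'b set" where
  "graph_code J t = J ` {(a, t a) | a. True}"

lemma inj_graph_code:
  assumes "inj J"
  shows "inj (graph_code J)"
proof (rule injI)
  fix s t :: "'a \<Rightarrow> nat"
  assume "graph_code J s = graph_code J t"
  then have graphs: "{(a, s a) | a. True} = {(a, t a) | a. True}"
    using assms by (simp add: graph_code_def inj_image_eq_iff)
  show "s = t"
  proof
    fix a
    have "(a, s a) \<in> {(a, t a) | a. True}"
      unfolding graphs[symmetric] by blast
    then show "s a = t a"
      by blast
  qed
qed

text \<open>
  A point \<open>x\<close>, a flag, a monomial and a coefficient, packed into one function \<open>'a \<Rightarrow> nat\<close>: its value at \<open>a\<close>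
  codes whether \<open>a\<close> is the point, together with the exponent at \<open>a\<close> and the two constants.
\<close>

definition term_code :: "'a \<Rightarrow> bool \<Rightarrow> ('a indet \<Rightarrow>\<^sub>0 nat) \<Rightarrow> rat \<Rightarrow> 'a \<Rightarrow> nat" where
  "term_code x b m r = (\<lambda>a. to_nat (a = x, b, r, Poly_Mapping.lookup m (Indet a)))"

lemma term_code_inject:
  assumes "term_code x b m r = term_code x' b' m' r'"
  shows "x = x'" "b = b'" "m = m'" "r = r'"
proof -
  have *: "(a = x, b, r, Poly_Mapping.lookup m (Indet a)) = (a = x', b', r', Poly_Mapping.lookup m' (Indet a))" for a
    using fun_cong[OF assms, of a] unfolding term_code_def by simp
  then show "x = x'" "b = b'" "r = r'"
    by auto
  have "Poly_Mapping.lookup m v = Poly_Mapping.lookup m' v" for v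
    using *[of "index v"] by (simp add: index_inverse)
  then show "m = m'"
    by (intro poly_mapping_eqI)
qed

text \<open>
  A function with values in the field is determined by the coefficients of chosen numerators
  (flag \<open>True\<close>) and denominators (flag \<open>False\<close>) of its values.
\<close>

definition function_code ::
    "('k \<Rightarrow> 'a indet mpoly \<times> 'a indet mpoly) \<Rightarrow> ('a \<Rightarrow> 'k) \<Rightarrow> ('a \<Rightarrow> nat) set" where
  "function_code rep f = {term_code x b m
     (Poly_Mapping.lookup (if b then fst (rep (f x)) else snd (rep (f x))) m) | x b m. True}"

lemma inj_function_code:
  assumes "inj rep"
  shows "inj (function_code rep)"
proof (rule injI)
  fix f g
  assume eq: "function_code rep f = function_code rep g"
  show "f = g"
  proof
    fix x
    have *: "Poly_Mapping.lookup (if b then fst (rep (f x)) else snd (rep (f x))) m =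
        Poly_Mapping.lookup (if b then fst (rep (g x)) else snd (rep (g x))) m" for b m
    proof -
      let ?r = "\<lambda>h x b m. Poly_Mapping.lookup (if b then fst (rep (h x)) else snd (rep (h x))) m"
      have "term_code x b m (?r f x b m) \<in> function_code rep f"
        unfolding function_code_def by (intro CollectI exI conjI TrueI) (rule refl)
      then have "term_code x b m (?r f x b m) \<in> function_code rep g"
        using eq by simp
      then obtain x' b' m' where code: "term_code x b m (?r f x b m) = term_code x' b' m' (?r g x' b' m')"
        unfolding function_code_def by blast
      note inject = term_code_inject[OF code]
      show ?thesis
        using inject(4) unfolding inject(1-3)[symmetric] .
    qed
    have "fst (rep (f x)) = fst (rep (g x))" "snd (rep (f x)) = snd (rep (g x))"
      using *[of True] *[of False] by (simp_all add: poly_mapping_eqI)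
    then show "f x = g x"
      using assms by (metis injD prod_eqI)
  qed
qed

text \<open>
  A set of functions \<open>'a \<Rightarrow> nat\<close> becomes a set of sets when each function is replaced by its graph, and
  pairs in \<open>'a \<times> nat\<close> can be coded in the infinite type \<open>'a + nat\<close>.
\<close>

lemma ex_inj_into_double_powerset:
  "\<exists>e :: ('a \<Rightarrow> 'a indet mpoly fract) \<Rightarrow> ('a + nat) set set. inj e"
proof -
  obtain J :: "'a \<times> nat \<Rightarrow> 'a + nat" where J: "inj J"
    using inj_prod_nat_sum by blast
  have "\<forall>z :: 'a indet mpoly fract. \<exists>pq. z = Fract (fst pq) (snd pq)"
    by (metis Fract_cases fst_conv snd_conv)
  then obtain rep :: "'a indet mpoly fract \<Rightarrow> 'a indet mpoly \<times> 'a indet mpoly"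
    where "\<And>z. z = Fract (fst (rep z)) (snd (rep z))"
    by metis
  then have "inj rep"
    by (metis injI)
  then have "inj (\<lambda>f. graph_code J ` function_code rep f)"
    using inj_function_code inj_graph_code[OF J] by (metis (no_types, lifting) injD injI inj_image_eq_iff)
  then show ?thesis
    by blast
qed

section \<open>The spectrum of the ring of sections\<close>

text \<open>
  Spectral spaces are defined through rings with a prescribed type of elements, so the ring of sections is
  transported along an injection \<open>e\<close>.
\<close>

definition coded_ring ::
    "(('a::complete_lattice \<Rightarrow> 'a indet mpoly fract) \<Rightarrow> 'c) \<Rightarrow> 'a set \<Rightarrow> 'c ring" where
  "coded_ring e X = \<lparr>carrier = e ` sections X,
     mult = (\<lambda>u v. e (\<lambda>x. inv_into UNIV e u x * inv_into UNIV e v x)), one = e (const_section X 1),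
     zero = e (\<lambda>x. 0), add = (\<lambda>u v. e (\<lambda>x. inv_into UNIV e u x + inv_into UNIV e v x))\<rparr>"

definition point_ideal ::
    "(('a::complete_lattice \<Rightarrow> 'a indet mpoly fract) \<Rightarrow> 'c) \<Rightarrow> 'a set \<Rightarrow> 'a \<Rightarrow> 'c set" where
  "point_ideal e X x = e ` {f \<in> sections X. f x = 0}"

context patch_compact
begin

context
  fixes e :: "('a \<Rightarrow> 'a indet mpoly fract) \<Rightarrow> 'c"
  assumes e: "inj e"
begin

lemma coded_ring_simps [simp]:
  "carrier (coded_ring e X) = e ` sections X"
  "e f \<otimes>\<^bsub>coded_ring e X\<^esub> e g = e (\<lambda>x. f x * g x)"
  "e f \<oplus>\<^bsub>coded_ring e X\<^esub> e g = e (\<lambda>x. f x + g x)"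
  "\<zero>\<^bsub>coded_ring e X\<^esub> = e (\<lambda>x. 0)"
  "\<one>\<^bsub>coded_ring e X\<^esub> = e (const_section X 1)"
  using e by (simp_all add: coded_ring_def)

lemma const_section_one_mult: "f \<in> sections X \<Longrightarrow> (\<lambda>x. const_section X 1 x * f x) = f"
  using sectionsD(1) by (fastforce simp: const_section_def)

lemma cring_coded_ring: "cring (coded_ring e X)"
proof (intro cringI abelian_groupI comm_monoidI)
  fix u assume "u \<in> carrier (coded_ring e X)"
  then obtain f where f: "f \<in> sections X" "u = e f" by auto
  show "\<one>\<^bsub>coded_ring e X\<^esub> \<otimes>\<^bsub>coded_ring e X\<^esub> u = u"
    using f by (simp only: coded_ring_simps const_section_one_mult)
  show "\<exists>v\<in>carrier (coded_ring e X). v \<oplus>\<^bsub>coded_ring e X\<^esub> u = \<zero>\<^bsub>coded_ring e X\<^esub>"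
    using f section_uminus[OF f(1)] by (intro bexI[of _ "e (\<lambda>x. - f x)"]) simp_all
qed (auto simp: section_add section_mult zero_section[OF X] const_section[OF X] algebra_simps)

lemma point_ideal_prime:
  assumes x: "x \<in> X"
  shows "primeideal (point_ideal e X x) (coded_ring e X)"
proof -
  interpret R: cring "coded_ring e X"
    by (rule cring_coded_ring)
  have neg: "\<ominus>\<^bsub>coded_ring e X\<^esub> e f = e (\<lambda>x. - f x)" if f: "f \<in> sections X" for f
    using f section_uminus[OF f] by (intro R.minus_equality) simp_all
  have mem: "e f \<in> point_ideal e X x \<longleftrightarrow> f \<in> sections X \<and> f x = 0" for f
    using e by (auto simp: point_ideal_def inj_eq)
  have sub: "point_ideal e X x \<subseteq> e ` sections X"
    by (auto simp: point_ideal_def)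
  show ?thesis
  proof (rule primeidealI)
    show "ideal (point_ideal e X x) (coded_ring e X)"
    proof (rule idealI)
      show "subgroup (point_ideal e X x) (add_monoid (coded_ring e X))"
      proof (rule R.add.subgroupI)
        show "point_ideal e X x \<noteq> {}"
          using mem[of "\<lambda>x. 0"] zero_section[OF X] by auto
      next
        fix u assume "u \<in> point_ideal e X x"
        moreover from this obtain f where "f \<in> sections X" "u = e f"
          using sub by blast
        ultimately show "\<ominus>\<^bsub>coded_ring e X\<^esub> u \<in> point_ideal e X x"
          by (simp add: neg mem section_uminus)
      next
        fix u v assume "u \<in> point_ideal e X x" "v \<in> point_ideal e X x"
        moreover from this obtain f g where "f \<in> sections X" "u = e f" "g \<in> sections X" "v = e g"
          using sub by blast
        ultimately show "u \<oplus>\<^bsub>coded_ring e X\<^esub> v \<in> point_ideal e X x"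
          by (simp add: mem section_add)
      qed (use sub in simp)
    next
      fix u r assume "u \<in> point_ideal e X x" "r \<in> carrier (coded_ring e X)"
      moreover from this obtain f g where "f \<in> sections X" "u = e f" "g \<in> sections X" "r = e g"
        using sub by auto
      ultimately show "r \<otimes>\<^bsub>coded_ring e X\<^esub> u \<in> point_ideal e X x"
        "u \<otimes>\<^bsub>coded_ring e X\<^esub> r \<in> point_ideal e X x"
        by (simp_all add: mem section_mult)
    qed (rule R.ring_axioms)
    show "carrier (coded_ring e X) \<noteq> point_ideal e X x"
      using mem[of "const_section X 1"] const_section[OF X, of 1] x by (auto simp: const_section_def)
  next
    fix u v
    assume "u \<in> carrier (coded_ring e X)" "v \<in> carrier (coded_ring e X)"
      and "u \<otimes>\<^bsub>coded_ring e X\<^esub> v \<in> point_ideal e X x"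
    then show "u \<in> point_ideal e X x \<or> v \<in> point_ideal e X x"
      by (auto simp: mem)
  qed (rule cring_coded_ring)
qed

lemma prime_is_point_ideal:
  assumes Q: "primeideal Q (coded_ring e X)"
  obtains x where "x \<in> X" "Q = point_ideal e X x"
proof -
  interpret primeideal Q "coded_ring e X"
    by (rule Q)
  define P where "P = {f \<in> sections X. e f \<in> Q}"
  have Q_eq: "Q = e ` P"
    using a_subset by (auto simp: P_def)
  obtain x where "x \<in> X" "P = {f \<in> sections X. f x = 0}"
  proof (rule prime_is_point)
    show "P \<subseteq> sections X"
      by (auto simp: P_def)
    show "(\<lambda>x. 0) \<in> P"
      using additive_subgroup.zero_closed[OF is_additive_subgroup] zero_section[OF X] by (simp add: P_def)
    show "const_section X 1 \<notin> P"
      using one_imp_carrier I_notcarr by (auto simp: P_def)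
    show "(\<lambda>x. f x + g x) \<in> P" if "f \<in> P" "g \<in> P" for f g
      using that additive_subgroup.a_closed[OF is_additive_subgroup, of "e f" "e g"] by (simp add: P_def section_add)
    show "(\<lambda>x. g x * f x) \<in> P" if "f \<in> P" "g \<in> sections X" for f g
      using that I_l_closed[of "e f" "e g"] by (simp add: P_def section_mult)
    show "f \<in> P \<or> g \<in> P" if "f \<in> sections X" "g \<in> sections X" "(\<lambda>x. f x * g x) \<in> P" for f g
      using that I_prime[of "e f" "e g"] by (simp add: P_def)
  qed
  then show ?thesis
    using that Q_eq by (simp add: point_ideal_def)
qed

lemma point_ideal_mem: "f \<in> sections X \<Longrightarrow> e f \<in> point_ideal e X x \<longleftrightarrow> f x = 0"
  using e by (auto simp: point_ideal_def inj_eq)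

text \<open>
  The prime ideal of \<open>x\<close> determines the set of all \<open>a \<le> x\<close>, hence \<open>x\<close> itself.
\<close>

lemma indet_section_mem:
  "x \<in> X \<Longrightarrow> e (indet_section X a) \<in> point_ideal e X x \<longleftrightarrow> a \<le> x"
  by (simp add: point_ideal_mem indet_section[OF X] indet_section_def V_def indet_fract_nonzero)

lemma inj_on_point_ideal: "inj_on (point_ideal e X) X"
  by (intro inj_onI antisym) (metis indet_section_mem order_refl)+

lemma prime_spectrum_coded_ring: "prime_spectrum (coded_ring e X) = point_ideal e X ` X"
  unfolding prime_spectrum_def using point_ideal_prime by (auto elim: prime_is_point_ideal)

lemma topspace_Spec_coded_ring:
  "topspace (Spec_topology (coded_ring e X)) = prime_spectrum (coded_ring e X)"
proof
  have "Spec_zero_set (coded_ring e X) (e ` sections X) = {}"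
    using primeideal.I_notcarr ideal.axioms(1) primeideal.axioms(1) additive_subgroup.a_subset
    by (fastforce simp: Spec_zero_set_def prime_spectrum_def)
  then have "openin (Spec_topology (coded_ring e X)) (prime_spectrum (coded_ring e X))"
    unfolding openin_Spec_topology by (metis Diff_empty coded_ring_simps(1) subset_refl)
  then show "prime_spectrum (coded_ring e X) \<subseteq> topspace (Spec_topology (coded_ring e X))"
    by (rule openin_subset)
  show "topspace (Spec_topology (coded_ring e X)) \<subseteq> prime_spectrum (coded_ring e X)"
    using openin_topspace[of "Spec_topology (coded_ring e X)"] unfolding openin_Spec_topology by blast
qed

text \<open>
  The map from \<open>X\<close> to the spectrum is continuous because the zeros of sections are closed. Its inverse is
  continuous because \<open>X - V X a\<close> is the set of points where \<open>indet_section X a\<close> does not vanish.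
\<close>

lemma zariski_homeomorphic_Spec: "zariski_cl X homeomorphic_space Spec_topology (coded_ring e X)"
proof -
  let ?R = "coded_ring e X"
  let ?\<phi> = "point_ideal e X"
  let ?\<psi> = "inv_into X ?\<phi>"
  have \<psi>: "?\<psi> (?\<phi> x) = x" if "x \<in> X" for x
    using inv_into_f_f[OF inj_on_point_ideal that] .
  have "continuous_map (zariski_cl X) (Spec_topology ?R) ?\<phi>"
    unfolding continuous_map_def
  proof (intro conjI allI impI)
    show "?\<phi> \<in> topspace (zariski_cl X) \<rightarrow> topspace (Spec_topology ?R)"
      by (auto simp: topspace_zariski_cl[OF X] topspace_Spec_coded_ring prime_spectrum_coded_ring)
    fix U assume "openin (Spec_topology ?R) U"
    then obtain E where E: "E \<subseteq> e ` sections X" "U = prime_spectrum ?R - Spec_zero_set ?R E"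
      unfolding openin_Spec_topology by auto
    then obtain F where F: "F \<subseteq> sections X" "E = e ` F"
      by (auto simp: subset_image_iff)
    have "{x \<in> X. ?\<phi> x \<in> U} = \<Union>((\<lambda>f. X - {x \<in> X. f x = 0}) ` F)"
      using F(1) point_ideal_mem unfolding E(2) F(2) prime_spectrum_coded_ring Spec_zero_set_def by blast
    also have "openin (zariski_cl X) \<dots>"
      using F(1) closedin_zeros by (intro openin_Union) (auto simp: closedin_def topspace_zariski_cl[OF X])
    finally show "openin (zariski_cl X) {x \<in> topspace (zariski_cl X). ?\<phi> x \<in> U}"
      by (simp add: topspace_zariski_cl[OF X])
  qed
  moreover have "continuous_map (Spec_topology ?R) (zariski_cl X) ?\<psi>"
    unfolding zariski_cl_def
  proof (rule continuous_on_generated_topo)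
    fix U assume "U \<in> {X - V X a | a. True}"
    then obtain a where U: "U = X - V X a"
      by blast
    have "?\<psi> -` U \<inter> prime_spectrum ?R = prime_spectrum ?R - Spec_zero_set ?R {e (indet_section X a)}"
      unfolding U prime_spectrum_coded_ring Spec_zero_set_def
      using \<psi> indet_section_mem by (auto simp: V_def)
    then show "openin (Spec_topology ?R) (?\<psi> -` U \<inter> topspace (Spec_topology ?R))"
      unfolding openin_Spec_topology topspace_Spec_coded_ring
      using indet_section[OF X] by (intro exI[of _ "{e (indet_section X a)}"]) simp
  next
    have "\<Union>{X - V X a | a. True} = X"
      using topspace_zariski_cl[OF X] unfolding zariski_cl_def topology_generated_by_topspace .
    then show "?\<psi> ` topspace (Spec_topology ?R) \<subseteq> \<Union>{X - V X a | a. True}"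
      using \<psi> by (auto simp: topspace_Spec_coded_ring prime_spectrum_coded_ring)
  qed
  ultimately have "homeomorphic_maps (zariski_cl X) (Spec_topology ?R) ?\<phi> ?\<psi>"
    unfolding homeomorphic_maps_def topspace_zariski_cl[OF X] topspace_Spec_coded_ring
      prime_spectrum_coded_ring using \<psi> by auto
  then show ?thesis
    unfolding homeomorphic_space_def by blast
qed

end

lemma spectral_zariski: "spectral_space (zariski_cl X)"
proof -
  obtain e :: "('a \<Rightarrow> 'a indet mpoly fract) \<Rightarrow> ('a + nat) set set" where e: "inj e"
    using ex_inj_into_double_powerset by blast
  show ?thesis
    unfolding spectral_space_def
    using cring_coded_ring[OF e] zariski_homeomorphic_Spec[OF e] by blast
qed

end

section \<open>The ascending chain condition and compactness of the patch topology\<close>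

lemma V_radical [simp]: "V X (radical X a) = V X a"
proof -
  have "a \<le> p \<longleftrightarrow> Inf (V X a) \<le> p" if "p \<in> X" for p
  proof
    assume "a \<le> p"
    then show "Inf (V X a) \<le> p"
      using that by (auto simp: V_def intro: Inf_lower)
  next
    have "a \<le> Inf (V X a)"
      by (auto simp: V_def intro: Inf_greatest)
    also assume "Inf (V X a) \<le> p"
    finally show "a \<le> p" .
  qed
  then show ?thesis
    by (auto simp: V_def radical_def)
qed

lemma V_sup: "V X (sup a b) = V X a \<inter> V X b"
  by (auto simp: V_def)

text \<open>
  A strictly descending sequence of sets \<open>V X a\<close> would have a strictly ascending sequence of radicals.
\<close>

lemma wf_V_of_ACC:
  assumes "ACC_on (radical_elements X)"
  shows "wf {(a, b). V X a \<subset> V X b}"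
proof (rule ccontr)
  assume "\<not> wf {(a, b). V X a \<subset> V X b}"
  then obtain s :: "nat \<Rightarrow> 'a" where s: "\<And>i. V X (s (Suc i)) \<subset> V X (s i)"
    unfolding wf_iff_no_infinite_down_chain by auto
  have "mono (\<lambda>i. radical X (s i))"
    unfolding mono_iff_le_Suc radical_def using s by (blast intro: Inf_superset_mono)
  moreover have "range (\<lambda>i. radical X (s i)) \<subseteq> radical_elements X"
    by (auto simp: radical_elements_def radical_def[of X "radical X _"]) (simp add: radical_def)
  ultimately obtain N where "\<forall>n\<ge>N. radical X (s n) = radical X (s N)"
    using assms unfolding ACC_on_def by blast
  then have "radical X (s (Suc N)) = radical X (s N)"
    by (rule allE[of _ "Suc N"]) simp
  then have "V X (s (Suc N)) = V X (s N)"
    by (metis V_radical)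
  then show False
    using s[of N] by blast
qed

text \<open>
  A basic open neighbourhood of \<open>x\<close> that misses \<open>F\<close> is a finite intersection of sets \<open>X - V X b\<close>.
\<close>

lemma zariski_separation:
  assumes X: "X \<subseteq> UNIV - {top_class.top}"
    and F: "closedin (zariski_cl X) F" and x: "x \<in> X - F"
  obtains B where "finite B" "\<And>b. b \<in> B \<Longrightarrow> \<not> b \<le> x" "F \<subseteq> (\<Union>b\<in>B. V X b)"
proof -
  have ex: "\<exists>B. finite B \<and> (\<forall>b\<in>B. \<not> b \<le> x) \<and> X - U \<subseteq> (\<Union>b\<in>B. V X b)"
    if "generate_topology_on {X - V X a | a. True} U" "x \<in> U" for U
    using that
  proof (induction rule: generate_topology_on.induct)
    case (Int U W)
    then obtain B C where "finite B" "\<forall>b\<in>B. \<not> b \<le> x" "X - U \<subseteq> (\<Union>b\<in>B. V X b)"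
      "finite C" "\<forall>b\<in>C. \<not> b \<le> x" "X - W \<subseteq> (\<Union>b\<in>C. V X b)"
      by auto
    then show ?case
      by (intro exI[of _ "B \<union> C"]) auto
  next
    case (UN K)
    then obtain k where k: "k \<in> K" "x \<in> k" by blast
    then obtain B where "finite B" "\<forall>b\<in>B. \<not> b \<le> x" "X - k \<subseteq> (\<Union>b\<in>B. V X b)"
      using UN.IH[OF k] by (elim exE conjE)
    then show ?case
      using k(1) by (intro exI[of _ B]) auto
  next
    case (Basis U)
    then obtain a where "U = X - V X a" "\<not> a \<le> x"
      by (auto simp: V_def)
    then show ?case
      by (intro exI[of _ "{a}"]) auto
  qed simp
  have "openin (zariski_cl X) (X - F)" "F \<subseteq> X"
    using F by (simp_all add: closedin_def topspace_zariski_cl[OF X])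
  then have "generate_topology_on {X - V X a | a. True} (X - F)"
    unfolding zariski_cl_def openin_topology_generated_by_iff by simp
  from ex[OF this x] that \<open>F \<subseteq> X\<close> show ?thesis
    by (simp add: double_diff) metis
qed

text \<open>
  A patch-neighbourhood of \<open>p\<close> contains a finite intersection of sets \<open>V X a\<close> and \<open>X - V X b\<close> around \<open>p\<close>.
  Each such \<open>V X a\<close> contains \<open>V X p\<close>, so only the finitely many sets \<open>V X b\<close> are left uncovered.
\<close>

lemma patch_separation:
  assumes U: "openin (patch_topology X) U" and p: "p \<in> U"
  obtains B where "finite B" "\<And>b. b \<in> B \<Longrightarrow> \<not> b \<le> p" "V X p \<subseteq> U \<union> (\<Union>b\<in>B. V X b)"
proof -
  have "\<exists>B. finite B \<and> (\<forall>b\<in>B. \<not> b \<le> p) \<and> V X p \<subseteq> U \<union> (\<Union>b\<in>B. V X b)"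
    using U[unfolded patch_topology_def openin_topology_generated_by_iff] p
  proof (induction rule: generate_topology_on.induct)
    case (Int U W)
    then obtain B C where "finite B" "\<forall>b\<in>B. \<not> b \<le> p" "V X p \<subseteq> U \<union> (\<Union>b\<in>B. V X b)"
      "finite C" "\<forall>b\<in>C. \<not> b \<le> p" "V X p \<subseteq> W \<union> (\<Union>b\<in>C. V X b)"
      by auto
    then show ?case
      by (intro exI[of _ "B \<union> C"]) auto
  next
    case (UN K)
    then obtain k where k: "k \<in> K" "p \<in> k" by blast
    then obtain B where "finite B" "\<forall>b\<in>B. \<not> b \<le> p" "V X p \<subseteq> k \<union> (\<Union>b\<in>B. V X b)"
      using UN.IH by blast
    then show ?case
      using k(1) by (intro exI[of _ B]) auto
  next
    case (Basis U)
    then obtain a b where "U = V X a \<inter> (X - V X b)" "a \<le> p" "\<not> b \<le> p"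
      by (auto simp: V_def)
    then show ?case
      by (intro exI[of _ "{b}"]) (auto simp: V_def)
  qed simp
  then show ?thesis
    using that by blast
qed

text \<open>
  By Noetherian induction on the sets \<open>V X a\<close>. If \<open>V X a\<close> is irreducible, the radical condition provides a
  point \<open>p \<in> X\<close> with \<open>V X a = V X p\<close>. Whichever open set of a cover contains \<open>p\<close>, the rest of \<open>V X p\<close> lies in
  finitely many proper subsets \<open>V X (sup a b)\<close>, which are compact by induction. If \<open>V X a\<close> is nonempty and
  reducible, it is itself a finite union of such proper subsets.
\<close>

lemma compactin_V:
  assumes X: "X \<subseteq> UNIV - {top_class.top}"
    and ACC: "ACC_on (radical_elements X)" and rad: "radical_condition X"
  shows "compactin (patch_topology X) (V X a)"
  using wf_V_of_ACC[OF ACC]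
proof (induction a rule: wf_induct_rule)
  case (less a)
  have pieces: "compactin (patch_topology X) (\<Union>b\<in>B. V X (sup a b))"
    if B: "finite B" "\<And>b. b \<in> B \<Longrightarrow> \<not> V X a \<subseteq> V X b" for B
  proof (rule compactin_Union)
    fix Z assume "Z \<in> (\<lambda>b. V X (sup a b)) ` B"
    then obtain b where b: "b \<in> B" "Z = V X (sup a b)" by blast
    have "V X (sup a b) \<subset> V X a"
      using B(2)[OF b(1)] by (auto simp: V_sup)
    then show "compactin (patch_topology X) Z"
      unfolding b(2) by (intro less) simp
  qed (use B in simp)
  consider "V X a = {}" | "irreducible_in (zariski_cl X) (V X a)"
    | "V X a \<noteq> {}" "\<not> irreducible_in (zariski_cl X) (V X a)"
    by blast
  then show ?case
  proof cases
    case 2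
    define p where "p = radical X a"
    have p: "p \<in> X" "V X a = V X p"
      using 2 rad by (auto simp: p_def radical_condition_def irreducible_radicals_def)
    show ?thesis
      unfolding compactin_def
    proof (intro conjI allI impI)
      show "V X a \<subseteq> topspace (patch_topology X)"
        by (auto simp: topspace_patch_topology[OF X] V_def)
      fix \<U> assume \<U>: "(\<forall>U\<in>\<U>. openin (patch_topology X) U) \<and> V X a \<subseteq> \<Union>\<U>"
      have "p \<in> V X a"
        using p by (simp add: V_def)
      then obtain U where U: "U \<in> \<U>" "p \<in> U"
        using \<U> by blast
      then obtain B where B: "finite B" "\<And>b. b \<in> B \<Longrightarrow> \<not> b \<le> p" "V X p \<subseteq> U \<union> (\<Union>b\<in>B. V X b)"
        using patch_separation \<U> by metis
      have "\<not> V X a \<subseteq> V X b" if "b \<in> B" for b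
        using B(2)[OF that] \<open>p \<in> V X a\<close> by (auto simp: V_def)
      then have "compactin (patch_topology X) (\<Union>b\<in>B. V X (sup a b))"
        by (rule pieces[OF B(1)])
      moreover have "(\<Union>b\<in>B. V X (sup a b)) \<subseteq> \<Union>\<U>"
        using \<U> by (auto simp: V_sup)
      ultimately obtain \<F> where "finite \<F>" "\<F> \<subseteq> \<U>" "(\<Union>b\<in>B. V X (sup a b)) \<subseteq> \<Union>\<F>"
        using \<U> compactinD by metis
      then show "\<exists>\<F>. finite \<F> \<and> \<F> \<subseteq> \<U> \<and> V X a \<subseteq> \<Union>\<F>"
        using U B(3) p(2) by (intro exI[of _ "insert U \<F>"]) (auto simp: V_sup)
    qed
  next
    case 3
    have sub: "V X a \<subseteq> X"
      by (auto simp: V_def)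
    then obtain F G where FG: "closedin (zariski_cl X) F" "closedin (zariski_cl X) G"
      "V X a \<subseteq> F \<union> G" "\<not> V X a \<subseteq> F" "\<not> V X a \<subseteq> G"
      using 3 by (auto simp: irreducible_in_def topspace_zariski_cl[OF X])
    obtain x y where xy: "x \<in> V X a" "x \<notin> F" "y \<in> V X a" "y \<notin> G"
      using FG(4,5) by blast
    obtain B where B: "finite B" "\<And>b. b \<in> B \<Longrightarrow> \<not> b \<le> x" "F \<subseteq> (\<Union>b\<in>B. V X b)"
      using zariski_separation[OF X FG(1), of x] xy sub by blast
    obtain C where C: "finite C" "\<And>b. b \<in> C \<Longrightarrow> \<not> b \<le> y" "G \<subseteq> (\<Union>b\<in>C. V X b)"
      using zariski_separation[OF X FG(2), of y] xy sub by blast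
    have "compactin (patch_topology X) (\<Union>b\<in>B \<union> C. V X (sup a b))"
      using B(1,2) C(1,2) xy(1,3) by (intro pieces) (auto simp: V_def)
    also have "(\<Union>b\<in>B \<union> C. V X (sup a b)) = V X a"
      using FG(3) B(3) C(3) by (auto simp: V_sup)
    finally show ?thesis .
  qed simp
qed

lemma compact_patch_of_ACC:
  assumes X: "X \<subseteq> UNIV - {top_class.top}"
    and "ACC_on (radical_elements X)" "radical_condition X"
  shows "compact_space (patch_topology X)"
proof -
  have "V X bot_class.bot = X"
    by (auto simp: V_def)
  then show ?thesis
    using compactin_V[OF assms, of bot_class.bot]
    by (simp add: compact_space_def topspace_patch_topology[OF X])
qed

text \<open>
  For an increasing sequence \<open>c\<close> with supremum \<open>s\<close>, the patch-open sets \<open>V X s\<close> and \<open>X - V X (c i)\<close> cover \<open>X\<close>.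
  If finitely many of them suffice, then \<open>V X (c N) = V X s\<close> for some \<open>N\<close>.
\<close>

lemma ACC_of_compact_patch:
  assumes X: "X \<subseteq> UNIV - {top_class.top}" and compact: "compact_space (patch_topology X)"
  shows "ACC_on (radical_elements X)"
  unfolding ACC_on_def
proof (intro allI impI)
  fix c :: "nat \<Rightarrow> 'a"
  assume c: "range c \<subseteq> radical_elements X \<and> mono c"
  define s where "s = Sup (range c)"
  define \<U> where "\<U> = insert (V X s) (range (\<lambda>i. X - V X (c i)))"
  have "X \<subseteq> \<Union>\<U>"
    unfolding \<U>_def s_def by (auto simp: V_def Sup_le_iff)
  moreover have "openin (patch_topology X) U" if "U \<in> \<U>" for U
    using that openin_patch_V[OF X] openin_patch_compl_V unfolding \<U>_def by auto
  moreover have "compactin (patch_topology X) X"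
    using compact by (simp add: compact_space_def topspace_patch_topology[OF X])
  ultimately obtain \<F> where \<F>: "finite \<F>" "\<F> \<subseteq> \<U>" "X \<subseteq> \<Union>\<F>"
    using compactinD by metis
  have "finite (\<F> - {V X s})" "\<F> - {V X s} \<subseteq> range (\<lambda>i. X - V X (c i))"
    using \<F>(1,2) unfolding \<U>_def by auto
  then obtain I where I: "finite I" "\<F> - {V X s} = (\<lambda>i. X - V X (c i)) ` I"
    using finite_subset_image by metis
  define N where "N = Max (insert 0 I)"
  have "V X (c N) \<subseteq> V X s"
  proof
    fix x assume x: "x \<in> V X (c N)"
    have "x \<in> V X (c i)" if "i \<in> I" for i
      using that x I(1) c monoD[of c i N] by (auto simp: N_def V_def intro: order_trans)
    then have "x \<notin> A" if "A \<in> \<F> - {V X s}" for A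
      using that unfolding I(2) by blast
    moreover have "x \<in> \<Union>\<F>"
      using \<F>(3) x by (auto simp: V_def)
    ultimately show "x \<in> V X s"
      by blast
  qed
  have "c n = c N" if "N \<le> n" for n
  proof -
    have "V X (c n) = V X (c N)"
    proof
      show "V X (c n) \<subseteq> V X (c N)"
        using monoD[of c N n] c that order_trans[of "c N" "c n"] unfolding V_def by blast
      have "c n \<le> s"
        unfolding s_def by (rule Sup_upper) simp
      then show "V X (c N) \<subseteq> V X (c n)"
        using \<open>V X (c N) \<subseteq> V X s\<close> order_trans[of "c n" s] unfolding V_def by blast
    qed
    moreover have "radical X (c i) = c i" for i
      using c by (auto simp: radical_elements_def)
    ultimately show ?thesis
      unfolding radical_def by metis
  qed
  then show "\<exists>N. \<forall>n\<ge>N. c n = c N"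
    by blast
qed

section \<open>The characterization and the spectral space\<close>

theorem theorem1p54:
  fixes X :: "'a::complete_lattice set"
  assumes "X \<subseteq> UNIV - {top_class.top}"
  shows "(radical_condition X \<longrightarrow>
           (ACC_on (radical_elements X) \<longleftrightarrow> compact_space (patch_topology X)))
       \<and> (ACC_on (radical_elements X) \<and> radical_condition X \<longrightarrow>
           spectral_space (zariski_cl X))"
proof (intro conjI impI)
  assume "radical_condition X"
  then show "ACC_on (radical_elements X) \<longleftrightarrow> compact_space (patch_topology X)"
    using compact_patch_of_ACC[OF assms] ACC_of_compact_patch[OF assms] by blast
next
  assume "ACC_on (radical_elements X) \<and> radical_condition X"
  then have "compact_space (patch_topology X)"
    using compact_patch_of_ACC[OF assms] by blast
  with assms interpret patch_compact X
    by unfold_locales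
  show "spectral_space (zariski_cl X)"
    by (rule spectral_zariski)
qed

end
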